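(* Let $\{Z_t\}_{t\ge 0}$ be a theta-positive branching process in varying environment with parameters $(\theta,\{\lambda_t\},\{a_t\})$, where $\theta\in(0,1]$. The process is asymptotically degenerate if and only if $\Lambda<\infty$. In this case, the limit $\lim_{t\to\infty}\mu_t=\mu$ exists with $0<\mu<\infty$, and, as $t\to\infty$, $Z_t$ converges almost surely to a random variable $Z_\infty$ such that $$\mathrm{E}(s^{Z_\infty})=1-\Big(V_\theta+(1+\theta)^{-1}(1-\mu^{-\theta})+\mu^{-\theta}(1-s)^{-\theta}\Big)^{-1/\theta},\qquad 0\le s\le1$$ (the right-hand side being read as $1$ for $s=1$).
   Context: Theta-positive branching process in varying environment with parameters $(\theta,\{\lambda_t\},\{a_t\})$: fix $\theta\in(0,1]$ and measurable functions $t\mapsto\lambda_t\ge0$ and $t\mapsto a_t$ on $[0,\infty)$ such that $\Lambda_t=\int_0^t\lambda_u\,du<\infty$ for all $t\ge0$ and $0\le a_t\le 1+1/\theta$ for all $t\ge 0$. The process $\{Z_t\}_{t\ge0}$ is the time-inhomogeneous continuous-time Markov branching process on $\{0,1,2,\dots\}$ with $Z_0=1$ (right-continuous sample paths) in which individuals live and reproduce independently; an individual alive at time $t$ dies during $(t,t+\delta)$ with probability $\lambda_t\delta+o(\delta)$ as $\delta\to0$, and an individual dying at time $t$ is instantaneously replaced by $k$ offspring with probability $p_t(k)$, where $k=0$ or $k\ge2$. (So from state $n$ the process jumps to $n-1+k$ at rate $n\lambda_tp_t(k)$ at time $t$.) The offspring probability generating function is $h_t(s)=p_t(0)+\sum_{k\ge2}p_t(k)s^k=1-a_t(1-s)+a_t(1+\theta)^{-1}(1-s)^{1+\theta}$,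 $0\le s\le 1$; in particular $a_t=\sum_{k\ge 2} kp_t(k)$ is the mean offspring number. Notation: $\mu_t=\mathrm{E}(Z_t)=\exp\{\int_0^t(a_u-1)\,d\Lambda_u\}$, where $d\Lambda_u=\lambda_u\,du$; $q=\lim_{t\to\infty}\mathrm{P}(Z_t=0)$ is the extinction probability; $\Lambda=\lim_{t\to\infty}\Lambda_t\in[0,\infty]$; $V_{t,\theta}=\theta(1+\theta)^{-1}\int_0^t\mu_u^{-\theta}\,d\Lambda_u$; $V_\theta=\lim_{t\to\infty}V_{t,\theta}\in[0,\infty]$. The process is called asymptotically degenerate if $q<1$ and $\liminf_{t\to\infty}\mu_t<\infty$. *)

theory Defs
  imports "HOL-Probability.Probability"
begin

definition cumulative_rate :: "(real \<Rightarrow> real) \<Rightarrow> real \<Rightarrow> real" where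
  "cumulative_rate lam t = (LBINT u:{0..t}. lam u)"

definition total_rate :: "(real \<Rightarrow> real) \<Rightarrow> ereal" where
  "total_rate lam = Lim at_top (\<lambda>t. ereal (cumulative_rate lam t))"

text \<open>
  Transition law \<open>P s t n\<close> of the population size at time \<open>t\<close>, given size \<open>n\<close> at time \<open>s\<close>, when
  individuals have death rate \<open>lam\<close> and offspring law \<open>p u\<close> at a death at time \<open>u\<close>.
  The conjuncts are: the Chapman--Kolmogorov equation; independence and identical distribution of
  the descendants of the individuals alive at time \<open>s\<close> (branching property); the offspring number
  is never 1; and the infinitesimal description of one individual.

  As \<open>lam\<close> and \<open>p\<close> are only measurable in time, \<open>lam t * \<delta> + o(\<delta>)\<close> at every single \<open>t\<close> is
  meaningful only if \<open>lam\<close> is regular, and if imposed at almost every \<open>t\<close> it does not exclude a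
  singular part of the death law. Hence the infinitesimals are integrated: with
  \<open>D = (LBINT u:{s..t}. lam u)\<close>, an individual alive at \<open>s\<close> dies during \<open>(s,t]\<close> with probability
  \<open>D + o(D)\<close>, and dies and is replaced by \<open>k\<close> offspring with probability
  \<open>(LBINT u:{s..t}. lam u * pmf (p u) k) + o(D)\<close>, as \<open>t - s \<rightarrow> 0\<close>, uniformly on compact time
  intervals. No death goes unnoticed in the population size, because the offspring number is not 1;
  further deaths among the offspring before \<open>t\<close> are of order \<open>o(D)\<close>.
\<close>
definition branching_transitions ::
    "(real \<Rightarrow> real) \<Rightarrow> (real \<Rightarrow> nat pmf) \<Rightarrow> (real \<Rightarrow> real \<Rightarrow> nat \<Rightarrow> nat pmf) \<Rightarrow> bool" where
  "branching_transitions lam p P \<longleftrightarrow>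
     (\<forall>s t u n. 0 \<le> s \<and> s \<le> t \<and> t \<le> u \<longrightarrow> P s u n = bind_pmf (P s t n) (P t u)) \<and>
     (\<forall>s t. 0 \<le> s \<and> s \<le> t \<longrightarrow>
        P s t 0 = return_pmf 0 \<and>
        (\<forall>n. P s t (Suc n) = map_pmf (\<lambda>(i, j). i + j) (pair_pmf (P s t 1) (P s t n)))) \<and>
     (\<forall>t\<ge>0. pmf (p t) 1 = 0) \<and>
     (\<forall>T \<epsilon>. \<epsilon> > 0 \<longrightarrow> (\<exists>\<eta>>0. \<forall>s t. 0 \<le> s \<and> s \<le> t \<and> t \<le> T \<and> t - s \<le> \<eta> \<longrightarrow>
        \<bar>(1 - pmf (P s t 1) 1) - (LBINT u:{s..t}. lam u)\<bar> \<le> \<epsilon> * (LBINT u:{s..t}. lam u))) \<and>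
     (\<forall>k T \<epsilon>. k \<noteq> 1 \<and> \<epsilon> > 0 \<longrightarrow> (\<exists>\<eta>>0. \<forall>s t. 0 \<le> s \<and> s \<le> t \<and> t \<le> T \<and> t - s \<le> \<eta> \<longrightarrow>
        \<bar>pmf (P s t 1) k - (LBINT u:{s..t}. lam u * pmf (p u) k)\<bar>
          \<le> \<epsilon> * (LBINT u:{s..t}. lam u)))"

text \<open>
  The last conjunct gives the finite-dimensional distributions; it expresses both the initial
  condition \<open>Z 0 = 1\<close> and the Markov property with transition law \<open>P\<close>. Right-continuity is with
  respect to the discrete topology of \<^typ>\<open>nat\<close>.
\<close>
definition markov_branching_process ::
    "'w measure \<Rightarrow> (real \<Rightarrow> real) \<Rightarrow> (real \<Rightarrow> nat pmf) \<Rightarrow> (real \<Rightarrow> 'w \<Rightarrow> nat) \<Rightarrow> bool" where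
  "markov_branching_process M lam p Z \<longleftrightarrow>
     prob_space M \<and>
     (\<forall>t\<ge>0. Z t \<in> measurable M (count_space UNIV)) \<and>
     (\<forall>\<omega>\<in>space M. \<forall>t\<ge>0. continuous (at_right t) (\<lambda>u. Z u \<omega>)) \<and>
     (\<exists>P. branching_transitions lam p P \<and>
        (\<forall>(\<tau> :: nat \<Rightarrow> real) (x :: nat \<Rightarrow> nat) (m :: nat). \<tau> 0 = 0 \<and> mono \<tau> \<longrightarrow>
           measure M {\<omega> \<in> space M. \<forall>i\<le>m. Z (\<tau> i) \<omega> = x i} =
             of_bool (x 0 = 1) * (\<Prod>i<m. pmf (P (\<tau> i) (\<tau> (Suc i)) (x i)) (x (Suc i)))))"

definition theta_pgf :: "real \<Rightarrow> real \<Rightarrow> real \<Rightarrow> real" where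
  "theta_pgf \<theta> a s = 1 - a * (1 - s) + a / (1 + \<theta>) * (1 - s) powr (1 + \<theta>)"

definition theta_positive_process ::
    "'w measure \<Rightarrow> (real \<Rightarrow> 'w \<Rightarrow> nat) \<Rightarrow> real \<Rightarrow> (real \<Rightarrow> real) \<Rightarrow> (real \<Rightarrow> real) \<Rightarrow> bool" where
  "theta_positive_process M Z \<theta> lam a \<longleftrightarrow>
     0 < \<theta> \<and> \<theta> \<le> 1 \<and>
     set_borel_measurable lborel {0..} lam \<and>
     set_borel_measurable lborel {0..} a \<and>
     (\<forall>t\<ge>0. 0 \<le> lam t) \<and>
     (\<forall>t\<ge>0. set_integrable lborel {0..t} lam) \<and>
     (\<forall>t\<ge>0. 0 \<le> a t \<and> a t \<le> 1 + 1 / \<theta>) \<and>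
     (\<exists>p. (\<forall>t\<ge>0. \<forall>s\<in>{0..1}. (\<lambda>k. pmf (p t) k * s ^ k) sums theta_pgf \<theta> (a t) s) \<and>
          markov_branching_process M lam p Z)"

definition mean_size :: "'w measure \<Rightarrow> (real \<Rightarrow> 'w \<Rightarrow> nat) \<Rightarrow> real \<Rightarrow> real" where
  "mean_size M Z t = (\<integral>\<omega>. real (Z t \<omega>) \<partial>M)"

definition extinction_prob :: "'w measure \<Rightarrow> (real \<Rightarrow> 'w \<Rightarrow> nat) \<Rightarrow> real" where
  "extinction_prob M Z = Lim at_top (\<lambda>t. measure M {\<omega> \<in> space M. Z t \<omega> = 0})"

definition V_fun ::
    "'w measure \<Rightarrow> (real \<Rightarrow> 'w \<Rightarrow> nat) \<Rightarrow> real \<Rightarrow> (real \<Rightarrow> real) \<Rightarrow> real \<Rightarrow> real" where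
  "V_fun M Z \<theta> lam t =
     \<theta> / (1 + \<theta>) * (LBINT u:{0..t}. mean_size M Z u powr (-\<theta>) * lam u)"

definition V_lim ::
    "'w measure \<Rightarrow> (real \<Rightarrow> 'w \<Rightarrow> nat) \<Rightarrow> real \<Rightarrow> (real \<Rightarrow> real) \<Rightarrow> ereal" where
  "V_lim M Z \<theta> lam = Lim at_top (\<lambda>t. ereal (V_fun M Z \<theta> lam t))"

definition asymptotically_degenerate :: "'w measure \<Rightarrow> (real \<Rightarrow> 'w \<Rightarrow> nat) \<Rightarrow> bool" where
  "asymptotically_degenerate M Z \<longleftrightarrow>
     extinction_prob M Z < 1 \<and> Liminf at_top (\<lambda>t. ereal (mean_size M Z t)) < \<infinity>"

end

theory Submission
  imports Defs "HOL-Complex_Analysis.Cauchy_Integral_Formula"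
begin

text \<open>
Fix \<open>t\<close> and \<open>0 \<le> x < 1\<close>, and let \<open>y s = 1 - E (x ^ Z t | Z s = 1)\<close>. The backward equation of the process is
\<open>y' = lam * ((1 - a) * y + a / (1 + \<theta>) * y powr (1 + \<theta>))\<close>, a Bernoulli equation: with
\<open>m s = exp (\<integral>\<^sub>0\<^sup>s (a - 1) * lam)\<close>, the quantity \<open>(m s * y s) powr (-\<theta>)\<close> has the derivative
\<open>- \<theta> / (1 + \<theta>) * lam * a * m powr (-\<theta>)\<close>, in which \<open>y\<close> no longer occurs. Integrating over
\<open>[0, t]\<close> gives the closed form of \<open>E (x ^ Z t)\<close> in \<open>survival_formula\<close>. The
difference quotients of this closed form at \<open>x = 1\<close> tend to \<open>m t\<close>, which is therefore the mean, and
\<open>x = 0\<close> gives the survival probability.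

The coefficients \<open>lam\<close> and \<open>a\<close> are only measurable, so the differential equation has no pointwise
meaning. All calculus is done with integrals instead. The tool is
\<open>constant_if_increments_negligible\<close>: a function whose increments over short intervals are
negligible against those of another function is constant. It yields the chain rule for indefinite
integrals, which replaces differentiation, and the integrated backward equation. For the latter the
infinitesimal description of the process, which speaks of one offspring number at a time, must be
summed over all offspring numbers (\<open>pgf_infinitesimal\<close>); this works because the mean offspring
number is at most \<open>1 + 1 / \<theta>\<close>, so that large offspring numbers are uniformly unlikely.

If \<open>\<Lambda> < \<infinity>\<close>, then \<open>m\<close> and \<open>V\<close> have finite limits, with \<open>m\<close> bounded away from 0, so survival has
positive probability and the process is asymptotically degenerate. Conversely, if \<open>q < 1\<close>, the
formula at \<open>x = 0\<close> bounds two nondecreasing functions, \<open>V t\<close> and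
\<open>V t + (1 - m t powr (-\<theta>)) / (1 + \<theta>)\<close>, so \<open>m t powr (-\<theta>)\<close> converges. Its limit is not 0 unless the
mean tends to infinity, and a positive limit makes \<open>V\<close>, the integral of \<open>m powr (-\<theta>)\<close> against
\<open>lam\<close>, at least a multiple of \<open>\<Lambda>\<close> for late times, whence \<open>\<Lambda> < \<infinity>\<close>.

For the almost sure convergence, the population changes between times \<open>s\<close> and \<open>t\<close> with probability at
most twice the mean at \<open>s\<close> times \<open>\<integral>\<^sub>s\<^sup>t lam\<close>. Summed over a grid, this bounds the probability of any
change after time \<open>N\<close> by a multiple of the tail of \<open>\<Lambda>\<close>; right-continuity extends the bound from
dyadic times to all times. Hence almost every path is eventually constant, and the generating
function of its limit is the limit of the generating functions.
\<close>


section \<open>Integrals over intervals and monotone limits\<close>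

text \<open>
Substitute for the mean value theorem when no derivatives exist. The bounds on short intervals add
up by the triangle inequality, because the increments of \<open>G\<close> telescope; so they hold on all of
\<open>[a, b]\<close> with arbitrarily small \<open>\<epsilon>\<close>.
\<close>

lemma constant_if_increments_negligible:
  fixes f G :: "real \<Rightarrow> real"
  assumes ab: "a \<le> b"
    and loc: "\<And>\<epsilon>. \<epsilon> > 0 \<Longrightarrow> \<exists>\<eta>>0. \<forall>s r. a \<le> s \<and> s \<le> r \<and> r \<le> b \<and> r - s < \<eta>
                 \<longrightarrow> \<bar>f r - f s\<bar> \<le> \<epsilon> * (G r - G s)"
  shows "f b = f a"
proof -
  have glob: "\<bar>f b - f a\<bar> \<le> \<epsilon> * (G b - G a)" if pos: "\<epsilon> > 0" for \<epsilon>
  proof -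
    obtain \<eta> where \<eta>: "\<eta> > 0"
      "\<And>s r. a \<le> s \<Longrightarrow> s \<le> r \<Longrightarrow> r \<le> b \<Longrightarrow> r - s < \<eta> \<Longrightarrow> \<bar>f r - f s\<bar> \<le> \<epsilon> * (G r - G s)"
      using loc[OF pos] by blast
    define P where "P s r \<longleftrightarrow> (a \<le> s \<and> r \<le> b \<longrightarrow> \<bar>f r - f s\<bar> \<le> \<epsilon> * (G r - G s))" for s r
    have "P a b"
    proof (rule Bolzano[OF ab])
      fix s r u assume "P s r" "P r u" "s \<le> r" "r \<le> u"
      then show "P s u" unfolding P_def by (auto simp: algebra_simps abs_le_iff)
    next
      fix x
      show "\<exists>d>0. \<forall>s r. s \<le> x \<and> x \<le> r \<and> r - s < d \<longrightarrow> P s r"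
        unfolding P_def using \<eta> by (intro exI[of _ \<eta>]) auto
    qed
    then show ?thesis by (simp add: P_def)
  qed
  have "\<bar>f b - f a\<bar> \<le> 0"
  proof (rule field_le_epsilon)
    fix e :: real assume e: "e > 0"
    define K where "K = \<bar>G b - G a\<bar> + 1"
    have K: "K > 0" "G b - G a \<le> K" unfolding K_def by auto
    have "\<bar>f b - f a\<bar> \<le> e / K * (G b - G a)"
      using e K by (intro glob) auto
    also have "\<dots> \<le> e / K * K"
      using e K by (intro mult_left_mono) auto
    finally show "\<bar>f b - f a\<bar> \<le> 0 + e" using K by simp
  qed
  then show ?thesis by simp
qed

lemma set_integrable_Icc_subset:
  fixes f :: "real \<Rightarrow> real"
  assumes "set_integrable lborel {a..b} f" "a \<le> s" "r \<le> b"
  shows "set_integrable lborel {s..r} f"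
  by (rule set_integrable_subset[OF assms(1)]) (use assms in auto)

lemma LBINT_Icc_combine:
  fixes f :: "real \<Rightarrow> real"
  assumes f: "set_integrable lborel {a..b} f" and "a \<le> c" "c \<le> b"
  shows "(LBINT u:{a..b}. f u) = (LBINT u:{a..c}. f u) + (LBINT u:{c..b}. f u)"
proof -
  have "set_integrable lborel {a..c} f" "set_integrable lborel {c..b} f"
    using assms by (auto intro: set_integrable_Icc_subset)
  then show ?thesis
    using Henstock_Kurzweil_Integration.integral_combine[OF assms(2,3) set_borel_integral_eq_integral(1)[OF f]] f
    by (simp add: set_borel_integral_eq_integral(2))
qed

lemma LBINT_Icc_diff:
  fixes f :: "real \<Rightarrow> real"
  assumes f: "set_integrable lborel {a..b} f" and "a \<le> s" "s \<le> r" "r \<le> b"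
  shows "(LBINT u:{a..r}. f u) - (LBINT u:{a..s}. f u) = (LBINT u:{s..r}. f u)"
  using LBINT_Icc_combine[of a r f s] assms set_integrable_Icc_subset[of a b f a r] by simp

lemma continuous_on_LBINT_Icc:
  fixes f :: "real \<Rightarrow> real"
  assumes f: "set_integrable lborel {a..b} f"
  shows "continuous_on {a..b} (\<lambda>r. LBINT u:{a..r}. f u)"
proof -
  have "continuous_on {a..b} (\<lambda>r. integral {a..r} f)"
    using set_borel_integral_eq_integral(1)[OF f] by (rule indefinite_integral_continuous_1)
  also have "?this \<longleftrightarrow> ?thesis"
    by (intro continuous_on_cong refl set_borel_integral_eq_integral(2)[symmetric]
          set_integrable_Icc_subset[OF f]) auto
  finally show ?thesis .
qed

lemma LBINT_singleton [simp]:
  fixes f :: "real \<Rightarrow> real"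
  shows "(LBINT u:{a}. f u) = 0"
proof -
  have "AE u in lborel. indicator {a} u *\<^sub>R f u = 0"
    using AE_lborel_singleton[of a] by eventually_elim auto
  then show ?thesis
    unfolding set_lebesgue_integral_def by (rule integral_eq_zero_AE)
qed

lemma set_integrable_mult_bounded:
  fixes f g :: "real \<Rightarrow> real"
  assumes f: "set_integrable lborel A f" and g: "set_borel_measurable lborel A g"
    and B: "\<And>x. x \<in> A \<Longrightarrow> \<bar>g x\<bar> \<le> B"
  shows "set_integrable lborel A (\<lambda>x. f x * g x)"
proof -
  have "(\<lambda>x. (indicator A x *\<^sub>R f x) * (indicator A x *\<^sub>R g x)) \<in> borel_measurable lborel"
    using f g unfolding set_integrable_def set_borel_measurable_def
    by (intro borel_measurable_times) auto
  also have "(\<lambda>x. (indicator A x *\<^sub>R f x) * (indicator A x *\<^sub>R g x)) = (\<lambda>x. indicator A x *\<^sub>R (f x * g x))"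
    by (auto simp: indicator_def)
  finally have meas: "set_borel_measurable lborel A (\<lambda>x. f x * g x)"
    unfolding set_borel_measurable_def .
  have "set_integrable lborel A (\<lambda>x. f x * B)" using f by simp
  then show ?thesis
  proof (rule set_integrable_bound)
    show "AE x in lborel. x \<in> A \<longrightarrow> norm (f x * g x) \<le> norm (f x * B)"
      using B by (intro always_eventually) (auto simp: abs_mult intro!: mult_left_mono order_trans[OF B])
  qed (use meas in \<open>simp_all add: set_borel_measurable_def\<close>)
qed

lemma LBINT_mult_bound:
  fixes f g :: "real \<Rightarrow> real"
  assumes f: "set_integrable lborel A f" and fg: "set_integrable lborel A (\<lambda>x. f x * g x)"
    and B: "\<And>x. x \<in> A \<Longrightarrow> \<bar>g x\<bar> \<le> B"
  shows "\<bar>LBINT x:A. f x * g x\<bar> \<le> B * (LBINT x:A. \<bar>f x\<bar>)"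
proof -
  have "\<bar>LBINT x:A. f x * g x\<bar> \<le> (LBINT x:A. \<bar>f x * g x\<bar>)"
    using set_integral_norm_bound[OF fg] by simp
  also have "\<dots> \<le> (LBINT x:A. \<bar>f x\<bar> * B)"
    by (intro set_integral_mono set_integrable_abs[OF fg] set_integrable_mult_left
              set_integrable_abs[OF f])
       (auto simp: abs_mult intro!: mult_left_mono B)
  finally show ?thesis by (simp add: mult.commute)
qed

lemma set_borel_measurable_continuous_Icc:
  fixes g :: "real \<Rightarrow> real"
  assumes "continuous_on {a..b} g"
  shows "set_borel_measurable lborel {a..b} g"
proof -
  have "set_borel_measurable borel {a..b} g"
    by (rule set_measurable_continuous_on[OF _ assms]) auto
  then show ?thesis by (simp add: set_borel_measurable_def)
qed

lemma continuous_on_Icc_bounded: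
  fixes g :: "real \<Rightarrow> real"
  assumes "continuous_on {a..b} g"
  obtains B where "\<And>x. x \<in> {a..b} \<Longrightarrow> \<bar>g x\<bar> \<le> B"
proof -
  have "bounded (g ` {a..b})"
    by (intro compact_imp_bounded compact_continuous_image assms compact_Icc)
  then obtain B where "\<forall>x\<in>{a..b}. \<bar>g x\<bar> \<le> B"
    unfolding bounded_iff by auto
  then show ?thesis by (intro that) auto
qed

lemma set_integrable_mult_continuous:
  fixes f g :: "real \<Rightarrow> real"
  assumes f: "set_integrable lborel {a..b} f" and g: "continuous_on {a..b} g"
  shows "set_integrable lborel {a..b} (\<lambda>x. f x * g x)"
proof -
  obtain B where "\<And>x. x \<in> {a..b} \<Longrightarrow> \<bar>g x\<bar> \<le> B" using continuous_on_Icc_bounded[OF g] by blast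
  with f set_borel_measurable_continuous_Icc[OF g] show ?thesis
    by (rule set_integrable_mult_bounded)
qed

lemma uniformly_continuous_on_Icc_delta:
  fixes g :: "real \<Rightarrow> real"
  assumes "continuous_on {a..b} g" "e > 0"
  obtains d where "d > 0" "\<And>x y. x \<in> {a..b} \<Longrightarrow> y \<in> {a..b} \<Longrightarrow> \<bar>x - y\<bar> < d \<Longrightarrow> \<bar>g x - g y\<bar> < e"
  using compact_uniformly_continuous[OF assms(1) compact_Icc] assms(2)
  unfolding uniformly_continuous_on_def dist_real_def by metis

text \<open>
The chain rule for the absolutely continuous function \<open>f\<close> with density \<open>\<psi>\<close>. On a short interval the
mean value theorem gives \<open>H (f r) - H (f s) = H' (f x) * (f r - f s)\<close> for an intermediate point
\<open>x\<close>, and replacing \<open>H' (f x)\<close> by \<open>H' (f u)\<close> under the integral costs little by uniform continuity.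
\<close>

lemma chain_rule_indefinite_integral:
  fixes f \<psi> H H' :: "real \<Rightarrow> real"
  assumes \<psi>: "set_integrable lborel {a..b} \<psi>"
    and f: "\<And>r. r \<in> {a..b} \<Longrightarrow> f r = c + (LBINT u:{a..r}. \<psi> u)"
    and H: "\<And>r. r \<in> {a..b} \<Longrightarrow> (H has_real_derivative H' (f r)) (at (f r))"
    and H': "continuous_on (f ` {a..b}) H'"
    and ab: "a \<le> b"
  shows "H (f b) - H (f a) = (LBINT u:{a..b}. \<psi> u * H' (f u))"
proof -
  have fc: "continuous_on {a..b} f"
    using continuous_on_LBINT_Icc[OF \<psi>] f
    by (subst continuous_on_cong[OF refl f]) (auto intro!: continuous_intros)
  have hc: "continuous_on {a..b} (\<lambda>u. H' (f u))"
    by (rule continuous_on_compose2[OF H' fc]) auto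
  have int: "set_integrable lborel {a..b} (\<lambda>u. \<psi> u * H' (f u))"
    by (rule set_integrable_mult_continuous[OF \<psi> hc])
  define Q where "Q r = H (f r) - (LBINT u:{a..r}. \<psi> u * H' (f u))" for r
  define G where "G r = (LBINT u:{a..r}. \<bar>\<psi> u\<bar>)" for r
  have "Q b = Q a"
  proof (rule constant_if_increments_negligible[OF ab, where G=G])
    fix \<epsilon> :: real assume e: "\<epsilon> > 0"
    obtain d where d: "d > 0" "\<And>x y. x \<in> {a..b} \<Longrightarrow> y \<in> {a..b} \<Longrightarrow> \<bar>x - y\<bar> < d
        \<Longrightarrow> \<bar>H' (f x) - H' (f y)\<bar> < \<epsilon>"
      using uniformly_continuous_on_Icc_delta[OF hc e] by blast
    show "\<exists>\<eta>>0. \<forall>s r. a \<le> s \<and> s \<le> r \<and> r \<le> b \<and> r - s < \<eta> \<longrightarrow> \<bar>Q r - Q s\<bar> \<le> \<epsilon> * (G r - G s)"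
    proof (intro exI[of _ d] conjI d(1) allI impI)
      fix s r assume A: "a \<le> s \<and> s \<le> r \<and> r \<le> b \<and> r - s < d"
      have sub: "{s..r} \<subseteq> {a..b}" using A by auto
      have fcs: "continuous_on {s..r} f" using fc sub by (rule continuous_on_subset)
      have \<psi>s: "set_integrable lborel {s..r} \<psi>"
        and ints: "set_integrable lborel {s..r} (\<lambda>u. \<psi> u * H' (f u))"
        using A \<psi> int by (auto intro: set_integrable_Icc_subset)
      have df: "f r - f s = (LBINT u:{s..r}. \<psi> u)"
        using f[of r] f[of s] A LBINT_Icc_diff[OF \<psi>, of s r] by simp
      obtain x where x: "x \<in> {s..r}" "H (f r) - H (f s) = H' (f x) * (f r - f s)"
      proof -
        have "\<exists>x\<in>{s..r}. H (f r) - H (f s) = H' (f x) * (f r - f s)"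
        proof (cases "f s = f r")
          case True
          then show ?thesis using A by auto
        next
          case False
          \<comment> \<open>All values between \<open>f s\<close> and \<open>f r\<close> are taken on \<open>[s, r]\<close>, so \<open>H\<close> is differentiable there.\<close>
          have hit: "\<exists>x\<in>{s..r}. f x = z" if "min (f s) (f r) \<le> z" "z \<le> max (f s) (f r)" for z
          proof (cases "f s \<le> f r")
            case True
            then show ?thesis using IVT'[of f s z r] that A fcs by auto
          next
            case False
            then show ?thesis using IVT2'[of f r z s] that A fcs by auto
          qed
          have der: "(H has_real_derivative H' z) (at z)"
            if "min (f s) (f r) \<le> z" "z \<le> max (f s) (f r)" for z
            using hit[OF that] H sub by auto
          have "min (f s) (f r) < max (f s) (f r)" using False by auto
          then obtain z where z: "z > min (f s) (f r)" "z < max (f s) (f r)"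
            "H (max (f s) (f r)) - H (min (f s) (f r)) = (max (f s) (f r) - min (f s) (f r)) * H' z"
            using MVT2[of "min (f s) (f r)" "max (f s) (f r)" H H'] der by auto
          then obtain x where x: "x \<in> {s..r}" "f x = z" using hit[of z] by auto
          have "H (f r) - H (f s) = H' z * (f r - f s)"
            using z(3) by (cases "f s \<le> f r") (auto simp: algebra_simps max_def min_def)
          with x show ?thesis by auto
        qed
        then show ?thesis using that by blast
      qed
      have "Q r - Q s = H' (f x) * (LBINT u:{s..r}. \<psi> u) - (LBINT u:{s..r}. \<psi> u * H' (f u))"
        unfolding Q_def using x(2) df LBINT_Icc_diff[OF int, of s r] A by simp
      also have "\<dots> = (LBINT u:{s..r}. \<psi> u * (H' (f x) - H' (f u)))"
        using \<psi>s ints by (simp add: right_diff_distrib set_integral_diff mult.commute)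
      also have "\<bar>\<dots>\<bar> \<le> \<epsilon> * (LBINT u:{s..r}. \<bar>\<psi> u\<bar>)"
      proof (rule LBINT_mult_bound[OF \<psi>s])
        show "set_integrable lborel {s..r} (\<lambda>u. \<psi> u * (H' (f x) - H' (f u)))"
          using \<psi>s ints by (simp add: right_diff_distrib set_integral_diff)
        show "\<bar>H' (f x) - H' (f u)\<bar> \<le> \<epsilon>" if "u \<in> {s..r}" for u
          using d(2)[of x u] that x(1) A by (auto simp: abs_less_iff)
      qed
      also have "(LBINT u:{s..r}. \<bar>\<psi> u\<bar>) = G r - G s"
        unfolding G_def using LBINT_Icc_diff[OF set_integrable_abs[OF \<psi>], of s r] A by simp
      finally show "\<bar>Q r - Q s\<bar> \<le> \<epsilon> * (G r - G s)" .
    qed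
  qed
  then show ?thesis unfolding Q_def by simp
qed

lemma tendsto_at_top_mono_bounded:
  fixes f :: "real \<Rightarrow> real"
  assumes mono: "\<And>s t. 0 \<le> s \<Longrightarrow> s \<le> t \<Longrightarrow> f s \<le> f t" and B: "\<And>t. 0 \<le> t \<Longrightarrow> f t \<le> B"
  obtains l where "(f \<longlongrightarrow> l) at_top" "\<forall>t\<ge>0. f t \<le> l"
proof -
  define l where "l = (SUP t\<in>{0..}. f t)"
  have bdd: "bdd_above (f ` {0..})" using B by (auto intro!: bdd_aboveI)
  have ub: "f t \<le> l" if "0 \<le> t" for t
    unfolding l_def using that bdd by (auto intro!: cSUP_upper)
  have "(f \<longlongrightarrow> l) at_top"
  proof (rule increasing_tendsto)
    show "\<forall>\<^sub>F t in at_top. f t \<le> l"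
      using eventually_ge_at_top[of 0] by eventually_elim (rule ub)
    fix x assume "x < l"
    then obtain s where s: "s \<ge> 0" "x < f s"
      unfolding l_def using less_cSUP_iff[OF _ bdd, of x] by auto
    show "\<forall>\<^sub>F t in at_top. x < f t"
      using eventually_ge_at_top[of s] by eventually_elim (use s mono[OF s(1)] in \<open>auto intro: less_le_trans less_imp_le\<close>)
  qed
  with ub show ?thesis using that by blast
qed

lemma ereal_Lim_at_top_finite_iff:
  fixes f :: "real \<Rightarrow> real"
  assumes mono: "\<And>s t. 0 \<le> s \<Longrightarrow> s \<le> t \<Longrightarrow> f s \<le> f t"
  shows "Lim at_top (\<lambda>t. ereal (f t)) < \<infinity> \<longleftrightarrow> (\<exists>B. \<forall>t\<ge>0. f t \<le> B)"
proof
  assume "\<exists>B. \<forall>t\<ge>0. f t \<le> B"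
  then obtain B where B: "\<And>t. 0 \<le> t \<Longrightarrow> f t \<le> B" by blast
  obtain l where "(f \<longlongrightarrow> l) at_top"
    by (rule tendsto_at_top_mono_bounded[OF mono B])
  then have "Lim at_top (\<lambda>t. ereal (f t)) = ereal l"
    by (intro tendsto_Lim) auto
  then show "Lim at_top (\<lambda>t. ereal (f t)) < \<infinity>" by simp
next
  assume fin: "Lim at_top (\<lambda>t. ereal (f t)) < \<infinity>"
  show "\<exists>B. \<forall>t\<ge>0. f t \<le> B"
  proof (rule ccontr)
    assume unb: "\<not> (\<exists>B. \<forall>t\<ge>0. f t \<le> B)"
    have "filterlim f at_top at_top"
      unfolding filterlim_at_top
    proof
      fix Z
      obtain s where s: "s \<ge> 0" "Z < f s" using unb by (auto simp: not_le)
      show "\<forall>\<^sub>F t in at_top. Z \<le> f t"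
        using eventually_ge_at_top[of s] by eventually_elim (use s mono[OF s(1)] in \<open>auto intro: less_le_trans less_imp_le\<close>)
    qed
    then have "((\<lambda>t. ereal (f t)) \<longlongrightarrow> \<infinity>) at_top" by (simp add: tendsto_PInfty_eq_at_top)
    then have "Lim at_top (\<lambda>t. ereal (f t)) = \<infinity>" by (intro tendsto_Lim) auto
    with fin show False by simp
  qed
qed

text \<open>
A power series with a nonzero coefficient has no zeros in a punctured neighbourhood of the origin,
but this one vanishes on \<open>[0, 1)\<close>.
\<close>

lemma power_series_zero_coeffs:
  fixes d :: "nat \<Rightarrow> real"
  assumes z: "\<And>s. s \<in> {0..<1} \<Longrightarrow> (\<lambda>k. d k * s ^ k) sums 0"
  shows "d k = 0"
proof (rule ccontr)
  assume k: "d k \<noteq> 0"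
  have d0: "d 0 = 0" using z[of 0] by simp
  with k have "k > 0" by (cases k) auto
  define f where "f x = (\<Sum>n. d n * x ^ n)" for x
  have sums: "(\<lambda>n. d n * (x - 0) ^ n) sums f x" if "norm (x - 0) < 1" for x
  proof -
    define s where "s = (1 + \<bar>x\<bar>) / 2"
    have s: "s \<in> {0..<1}" "\<bar>x\<bar> < \<bar>s\<bar>" using that unfolding s_def by auto
    then have "summable (\<lambda>n. d n * x ^ n)"
      using powser_inside[OF sums_summable[OF z[OF s(1)]], of x] by simp
    then show ?thesis unfolding f_def by (simp add: summable_sums)
  qed
  have f0: "f 0 = 0" using d0 sums[of 0] sums_unique2 powser_sums_zero[of d] by fastforce
  obtain e where e: "0 < e" "\<And>x. x \<in> cball 0 e - {0} \<Longrightarrow> f x \<noteq> 0"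
    using powser_0_nonzero[OF zero_less_one sums f0 k \<open>k > 0\<close>] by blast
  define x where "x = min e (1 / 2)"
  have x: "0 < x" "x \<le> e" "x < 1" using e(1) unfolding x_def by auto
  have "f x \<noteq> 0" using x by (intro e(2)) auto
  moreover have "f x = 0" using sums[of x] z[of x] x sums_unique2 by fastforce
  ultimately show False by simp
qed

lemma LINT_sum:
  fixes f :: "'i \<Rightarrow> 'b \<Rightarrow> real"
  assumes "\<And>i. i \<in> I \<Longrightarrow> set_integrable M A (f i)"
  shows "set_integrable M A (\<lambda>x. \<Sum>i\<in>I. f i x)" "(LINT x:A|M. \<Sum>i\<in>I. f i x) = (\<Sum>i\<in>I. LINT x:A|M. f i x)"
  using assms unfolding set_integrable_def set_lebesgue_integral_def
  by (simp_all add: sum_distrib_left)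

lemma powr_lipschitz_unit:
  fixes x y :: real
  assumes "0 < \<theta>" "x \<in> {0..1}" "y \<in> {0..1}"
  shows "\<bar>x powr (1 + \<theta>) - y powr (1 + \<theta>)\<bar> \<le> (1 + \<theta>) * \<bar>x - y\<bar>"
proof -
  have main: "\<bar>x powr (1 + \<theta>) - y powr (1 + \<theta>)\<bar> \<le> (1 + \<theta>) * \<bar>x - y\<bar>"
    if "0 \<le> y" "y < x" "x \<le> 1" for x y :: real
  proof -
    have "\<exists>z. y < z \<and> z < x \<and> x powr (1 + \<theta>) - y powr (1 + \<theta>) = (x - y) * ((1 + \<theta>) * z powr \<theta>)"
    proof (rule mvt[OF that(2), of "\<lambda>z. z powr (1 + \<theta>)" "\<lambda>z h. h * ((1 + \<theta>) * z powr \<theta>)", elim_format])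
      show "continuous_on {y..x} (\<lambda>z. z powr (1 + \<theta>))"
        using that assms(1) by (intro continuous_on_powr' continuous_intros) auto
      fix z assume z: "y < z" "z < x"
      have "((\<lambda>z. z powr (1 + \<theta>)) has_real_derivative (1 + \<theta>) * z powr \<theta>) (at z)"
        using z that by (auto intro!: derivative_eq_intros)
      then show "((\<lambda>z. z powr (1 + \<theta>)) has_derivative (\<lambda>h. h * ((1 + \<theta>) * z powr \<theta>))) (at z)"
        by (simp add: has_field_derivative_def mult_commute_abs)
    qed auto
    then obtain z where z: "y < z" "z < x"
      "x powr (1 + \<theta>) - y powr (1 + \<theta>) = (x - y) * ((1 + \<theta>) * z powr \<theta>)" by blast
    have "z powr \<theta> \<le> 1" using z that assms(1) by (intro powr_le1) auto
    moreover have "\<bar>x powr (1 + \<theta>) - y powr (1 + \<theta>)\<bar> = ((1 + \<theta>) * \<bar>x - y\<bar>) * z powr \<theta>"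
      unfolding z(3) using assms(1) that by (simp add: abs_mult)
    ultimately show ?thesis using assms(1) by (simp add: mult_left_le)
  qed
  consider "y < x" | "x = y" | "x < y" by linarith
  then show ?thesis
  proof cases
    case 1
    then show ?thesis using main[of y x] assms by simp
  next
    case 2
    then show ?thesis by simp
  next
    case 3
    then show ?thesis using main[of x y] assms by (simp add: abs_minus_commute)
  qed
qed

lemma dyadic_between:
  fixes u b :: real
  assumes "N \<le> u" "u < b"
  obtains j k :: nat where "u < N + real k / 2 ^ j" "N + real k / 2 ^ j < b"
proof -
  obtain j where j: "1 / 2 ^ j < b - u"
    using real_arch_pow_inv[of "b - u" "1/2"] assms by (auto simp: power_divide)
  define k where "k = nat (\<lfloor>(u - N) * 2 ^ j\<rfloor> + 1)"
  have "real k = of_int \<lfloor>(u - N) * 2 ^ j\<rfloor> + 1"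
    using assms unfolding k_def by simp
  then have k: "(u - N) * 2 ^ j < real k" "real k \<le> (u - N) * 2 ^ j + 1" by linarith+
  have "u - N < real k / 2 ^ j" using k(1) by (simp add: field_simps)
  moreover have "real k / 2 ^ j \<le> (u - N) + 1 / 2 ^ j"
    using divide_right_mono[OF k(2), of "2 ^ j"] by (simp add: add_divide_distrib)
  ultimately show ?thesis using j by (intro that[of k j]) linarith+
qed


section \<open>Probability generating functions\<close>

definition pgf :: "nat pmf \<Rightarrow> real \<Rightarrow> real" where
  "pgf q v = measure_pmf.expectation q (\<lambda>k. v ^ k)"

lemma integrable_pgf:
  fixes v :: real and q :: "nat pmf"
  assumes "v \<in> {0..1}"
  shows "integrable (measure_pmf q) (\<lambda>k. v ^ k)"
  by (rule measure_pmf.integrable_const_bound[where B=1])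
     (use assms in \<open>auto intro!: power_le_one always_eventually\<close>)

lemma nn_integral_pgf:
  fixes v :: real
  assumes "v \<in> {0..1}"
  shows "(\<integral>\<^sup>+k. ennreal (v ^ k) \<partial>measure_pmf q) = ennreal (pgf q v)"
  unfolding pgf_def using assms
  by (intro nn_integral_eq_integral integrable_pgf) auto

lemma pgf_nonneg: "v \<in> {0..1} \<Longrightarrow> 0 \<le> pgf q v"
  unfolding pgf_def by (intro integral_nonneg_AE) auto

lemma pgf_1 [simp]: "pgf q 1 = 1"
  by (simp add: pgf_def)

lemma pgf_mono:
  assumes "0 \<le> v" "v \<le> w" "w \<le> 1"
  shows "pgf q v \<le> pgf q w"
  unfolding pgf_def using assms by (intro integral_mono integrable_pgf power_mono) auto

lemma pgf_le_1: "v \<in> {0..1} \<Longrightarrow> pgf q v \<le> 1"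
  using pgf_mono[of v 1 q] by simp

lemma pmf_expectation_sums:
  fixes f :: "nat \<Rightarrow> real"
  assumes f: "integrable (measure_pmf q) f"
  shows "(\<lambda>k. pmf q k * f k) sums measure_pmf.expectation q f"
proof -
  have "integrable (density (count_space UNIV) (\<lambda>k. ennreal (pmf q k))) f"
    using f by (simp add: measure_pmf_eq_density)
  then have "integrable (count_space UNIV) (\<lambda>k. pmf q k * f k)"
    by (subst (asm) integrable_density) auto
  then have "(\<lambda>k. pmf q k * f k) sums (\<integral>k. pmf q k * f k \<partial>count_space UNIV)"
    by (rule sums_integral_count_space_nat)
  also have "(\<integral>k. pmf q k * f k \<partial>count_space UNIV) = measure_pmf.expectation q f"
    unfolding measure_pmf_eq_density by (subst integral_density) auto
  finally show ?thesis .
qed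

lemma pgf_sums:
  "v \<in> {0..1} \<Longrightarrow> (\<lambda>k. pmf q k * v ^ k) sums pgf q v"
  unfolding pgf_def by (intro pmf_expectation_sums integrable_pgf)

lemma pgf_0: "pgf q 0 = pmf q 0"
proof -
  have "(\<lambda>k. (0::real) ^ k) = indicator {0::nat}" by (auto simp: indicator_def)
  then show ?thesis unfolding pgf_def by (simp add: measure_pmf_single)
qed

lemma pgf_partial_sum_le:
  assumes v: "v \<in> {0..1}"
  shows "(\<Sum>k<K. pmf q k * v ^ k) \<le> pgf q v"
  using sum_le_suminf[OF sums_summable[OF pgf_sums[OF v]], of "{..<K}"] sums_unique[OF pgf_sums[OF v]] v
  by auto

text \<open>
The discarded terms of the generating function are at most the discarded probability.
\<close>

lemma pgf_le_partial_sum: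
  assumes v: "v \<in> {0..1}"
  shows "pgf q v \<le> (\<Sum>k<K. pmf q k * v ^ k) + (1 - (\<Sum>k<K. pmf q k))"
proof -
  have s: "(\<lambda>k. pmf q k * (1 - v ^ k)) sums (1 - pgf q v)"
    using sums_diff[OF pgf_sums[of 1 q] pgf_sums[OF v, of q]] by (simp add: algebra_simps)
  have "(\<Sum>k<K. pmf q k * (1 - v ^ k)) \<le> (\<Sum>k. pmf q k * (1 - v ^ k))"
    using v by (intro sum_le_suminf[OF sums_summable[OF s]]) (auto intro!: mult_nonneg_nonneg power_le_one)
  then show ?thesis using sums_unique[OF s] by (simp add: algebra_simps sum_subtractf)
qed

lemma sum_pmf_le_1: "(\<Sum>k<K. pmf q (k::nat)) \<le> 1"
  using pgf_partial_sum_le[of 1 q K] by simp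

text \<open>
A Markov inequality in terms of the generating function: beyond \<open>K\<close>, the weight \<open>1 - v ^ k\<close> is at
least \<open>1 - v ^ K\<close>.
\<close>

lemma pgf_tail_bound:
  assumes v: "v \<in> {0..1}"
  shows "(1 - (\<Sum>k<K. pmf q k)) * (1 - v ^ K) \<le> 1 - pgf q v"
proof -
  have s: "(\<lambda>k. pmf q k * v ^ k) sums pgf q v" by (rule pgf_sums[OF v])
  have s1: "(\<lambda>k. pmf q k) sums 1" using pgf_sums[of 1 q] by simp
  have "(\<lambda>k. pmf q (k + K) * v ^ (k + K)) sums (pgf q v - (\<Sum>k<K. pmf q k * v ^ k))"
    using sums_iff_shift'[of "\<lambda>k. pmf q k * v ^ k" K] s by simp
  moreover have "(\<lambda>k. pmf q (k + K) * v ^ K) sums ((1 - (\<Sum>k<K. pmf q k)) * v ^ K)"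
    using sums_mult2[of "\<lambda>k. pmf q (k + K)"] sums_iff_shift'[of "\<lambda>k. pmf q k" K] s1 by simp
  moreover have le: "pmf q (k + K) * v ^ (k + K) \<le> pmf q (k + K) * v ^ K" for k
    using v by (intro mult_left_mono power_decreasing) auto
  ultimately have "pgf q v - (\<Sum>k<K. pmf q k * v ^ k) \<le> (1 - (\<Sum>k<K. pmf q k)) * v ^ K"
    by (intro sums_le[OF le])
  moreover have "(\<Sum>k<K. pmf q k * v ^ k) \<le> (\<Sum>k<K. pmf q k)"
    using v by (intro sum_mono) (auto intro!: mult_left_le power_le_one)
  ultimately show ?thesis by (simp add: algebra_simps)
qed

lemma one_minus_pgf_ge:
  assumes v: "v \<in> {0..1}"
  shows "pmf q 1 * (1 - v) \<le> 1 - pgf q v"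
  using pgf_le_partial_sum[OF v, of q 2] by (simp add: eval_nat_numeral algebra_simps)

lemma pgf_return_0 [simp]: "pgf (return_pmf 0) v = 1"
  by (simp add: pgf_def)

lemma pgf_add_indep:
  assumes v: "v \<in> {0..1}"
  shows "pgf (map_pmf (\<lambda>(i, j). i + j) (pair_pmf q r)) v = pgf q v * pgf r v"
proof -
  have "ennreal (pgf (map_pmf (\<lambda>(i, j). i + j) (pair_pmf q r)) v)
        = (\<integral>\<^sup>+i. \<integral>\<^sup>+j. ennreal (v ^ i) * ennreal (v ^ j) \<partial>measure_pmf r \<partial>measure_pmf q)"
    unfolding nn_integral_pgf[OF v, symmetric] using v
    by (simp add: nn_integral_pair_pmf' power_add ennreal_mult)
  also have "\<dots> = ennreal (pgf q v) * ennreal (pgf r v)"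
    by (simp add: nn_integral_cmult nn_integral_multc nn_integral_pgf[OF v])
  finally show ?thesis
    using pgf_nonneg[OF v] by (simp flip: ennreal_mult)
qed

lemma pgf_bind:
  assumes v: "v \<in> {0..1}" and w: "w \<in> {0..1}" and N: "\<And>n. pgf (N n) v = w ^ n"
  shows "pgf (bind_pmf q N) v = pgf q w"
proof -
  have "ennreal (pgf (bind_pmf q N) v) = (\<integral>\<^sup>+k. ennreal (v ^ k) \<partial>measure_pmf (bind_pmf q N))"
    by (rule nn_integral_pgf[OF v, symmetric])
  also have "\<dots> = (\<integral>\<^sup>+n. \<integral>\<^sup>+k. ennreal (v ^ k) \<partial>measure_pmf (N n) \<partial>measure_pmf q)"
    by (rule nn_integral_bind_pmf)
  also have "\<dots> = (\<integral>\<^sup>+n. ennreal (w ^ n) \<partial>measure_pmf q)"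
    by (simp add: nn_integral_pgf[OF v] N)
  also have "\<dots> = ennreal (pgf q w)" by (rule nn_integral_pgf[OF w])
  finally show ?thesis using pgf_nonneg[OF v] pgf_nonneg[OF w] by simp
qed

lemma pmf_bind_ge: "pmf q j * pmf (N j) k \<le> pmf (bind_pmf q N) k"
proof -
  have "pmf q j * pmf (N j) k = (\<integral>x. indicator {j} x * pmf (N j) k \<partial>measure_pmf q)"
    by (simp add: measure_pmf_single)
  also have "\<dots> \<le> (\<integral>x. pmf (N x) k \<partial>measure_pmf q)"
    by (intro integral_mono measure_pmf.integrable_const_bound[where B=1])
       (auto simp: indicator_def pmf_le_1)
  finally show ?thesis by (simp add: pmf_bind)
qed

lemma pmf_map_pair_ge:
  "pmf q i * pmf r j \<le> pmf (map_pmf (\<lambda>(i, j). i + j) (pair_pmf q r)) (i + j :: nat)"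
proof -
  have "pmf q i * pmf r j = measure (pair_pmf q r) {(i, j)}"
    by (simp add: measure_pmf_single pmf_pair)
  also have "\<dots> \<le> measure (pair_pmf q r) ((\<lambda>(i, j). i + j) -` {i + j})"
    by (intro measure_pmf.finite_measure_mono) auto
  also have "\<dots> = pmf (map_pmf (\<lambda>(i, j). i + j) (pair_pmf q r)) (i + j)"
    by (simp add: pmf_map)
  finally show ?thesis .
qed

text \<open>
\<open>(1 - x ^ k) / (1 - x)\<close> is the geometric sum \<open>\<Sum>i<k. x ^ i\<close>, which increases to \<open>k\<close> as \<open>x\<close> increases
to 1; so the mean, including its finiteness, follows by monotone convergence.
\<close>

lemma mean_of_pgf:
  assumes lim: "((\<lambda>x. (1 - pgf q x) / (1 - x)) \<longlongrightarrow> m) (at_left 1)"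
  shows "integrable (measure_pmf q) real" "measure_pmf.expectation q real = m"
proof -
  \<comment> \<open>A sequence that increases to 1; monotone convergence is about sequences.\<close>
  define x where "x j = 1 - 1 / real (Suc j)" for j
  have x: "x j \<in> {0..<1}" for j unfolding x_def by (auto simp: field_simps)
  have xmono: "x i \<le> x j" if "i \<le> j" for i j
    using that unfolding x_def by (auto simp: field_simps)
  have xlim: "x \<longlonglongrightarrow> 1"
    unfolding x_def using tendsto_diff[OF tendsto_const LIMSEQ_inverse_real_of_nat, of 1]
    by (simp add: inverse_eq_divide)
  then have xleft: "filterlim x (at_left 1) sequentially"
    unfolding filterlim_at using x by (auto intro!: always_eventually simp: less_imp_neq)
  have avg: "(1 - x j ^ k) / (1 - x j) = (\<Sum>i<k. x j ^ i)" for j k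
    using x[of j] by (subst one_diff_power_eq) auto
  have int: "integrable (measure_pmf q) (\<lambda>k. \<Sum>i<k. x j ^ i)" for j
    unfolding avg[symmetric] using x[of j]
    by (intro Bochner_Integration.integrable_divide Bochner_Integration.integrable_diff integrable_pgf) auto
  have E: "(\<integral>k. (\<Sum>i<k. x j ^ i) \<partial>measure_pmf q) = (1 - pgf q (x j)) / (1 - x j)" for j
    unfolding avg[symmetric] pgf_def using x[of j]
    by (subst integral_divide_zero, subst Bochner_Integration.integral_diff) (auto intro: integrable_pgf)
  have mono: "AE k in measure_pmf q. mono (\<lambda>j. \<Sum>i<k. x j ^ i)"
    by (intro always_eventually allI monoI sum_mono power_mono xmono) (use x in auto)
  have pt: "AE k in measure_pmf q. (\<lambda>j. \<Sum>i<k. x j ^ i) \<longlonglongrightarrow> real k"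
  proof (intro always_eventually allI)
    fix k
    have "(\<lambda>j. \<Sum>i<k. x j ^ i) \<longlonglongrightarrow> (\<Sum>i<k. 1 ^ i)"
      by (intro tendsto_sum tendsto_power xlim)
    then show "(\<lambda>j. \<Sum>i<k. x j ^ i) \<longlonglongrightarrow> real k" by simp
  qed
  have conv: "(\<lambda>j. \<integral>k. (\<Sum>i<k. x j ^ i) \<partial>measure_pmf q) \<longlonglongrightarrow> m"
    unfolding E using filterlim_compose[OF lim xleft] .
  show "integrable (measure_pmf q) real" "measure_pmf.expectation q real = m"
    using integrable_monotone_convergence[OF int mono pt conv]
      integral_monotone_convergence[OF int mono pt conv] by auto
qed


section \<open>Transition laws of the branching process\<close>

text \<open>
The parameters together with a transition law, but without a process: the generating functions
depend on the transition law alone.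
\<close>

locale theta_branching =
  fixes \<theta> :: real and lam a :: "real \<Rightarrow> real" and p :: "real \<Rightarrow> nat pmf"
    and P :: "real \<Rightarrow> real \<Rightarrow> nat \<Rightarrow> nat pmf"
  assumes \<theta>: "0 < \<theta>" "\<theta> \<le> 1"
    and a_meas: "set_borel_measurable lborel {0..} a"
    and lam_nonneg: "\<And>t. 0 \<le> t \<Longrightarrow> 0 \<le> lam t"
    and lam_int0: "\<And>t. 0 \<le> t \<Longrightarrow> set_integrable lborel {0..t} lam"
    and a_bounds: "\<And>t. 0 \<le> t \<Longrightarrow> 0 \<le> a t" "\<And>t. 0 \<le> t \<Longrightarrow> a t \<le> 1 + 1 / \<theta>"
    and offspring: "\<And>t s. 0 \<le> t \<Longrightarrow> s \<in> {0..1} \<Longrightarrow> (\<lambda>k. pmf (p t) k * s ^ k) sums theta_pgf \<theta> (a t) s"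
    and trans: "branching_transitions lam p P"
begin

abbreviation \<Lambda> :: "real \<Rightarrow> real \<Rightarrow> real" where
  "\<Lambda> s t \<equiv> LBINT u:{s..t}. lam u"

abbreviation F :: "real \<Rightarrow> real \<Rightarrow> real \<Rightarrow> real" where
  "F s t v \<equiv> pgf (P s t 1) v"

lemma lam_int: "0 \<le> s \<Longrightarrow> set_integrable lborel {s..t} lam"
  using set_integrable_Icc_subset[OF lam_int0[of "max 0 t"], of s t] by auto

lemma \<Lambda>_nonneg: "0 \<le> s \<Longrightarrow> 0 \<le> \<Lambda> s t"
  unfolding set_lebesgue_integral_def
  by (intro integral_nonneg_AE always_eventually) (auto simp: indicator_def lam_nonneg)

lemma \<Lambda>_add: "0 \<le> s \<Longrightarrow> s \<le> t \<Longrightarrow> t \<le> u \<Longrightarrow> \<Lambda> s u = \<Lambda> s t + \<Lambda> t u"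
  by (intro LBINT_Icc_combine lam_int)

lemma \<Lambda>_mono: "0 \<le> s \<Longrightarrow> s \<le> s' \<Longrightarrow> s' \<le> t' \<Longrightarrow> t' \<le> t \<Longrightarrow> \<Lambda> s' t' \<le> \<Lambda> s t"
  using \<Lambda>_add[of s s' t] \<Lambda>_add[of s' t' t] \<Lambda>_nonneg[of s s'] \<Lambda>_nonneg[of t' t] by simp

text \<open>
Uniform absolute continuity of the integral of \<open>lam\<close>; it turns bounds by the integrated rate into
statements about short time intervals.
\<close>

lemma \<Lambda>_small:
  assumes "0 \<le> T" "e > 0"
  obtains d where "d > 0" "\<And>s r. 0 \<le> s \<Longrightarrow> s \<le> r \<Longrightarrow> r \<le> T \<Longrightarrow> r - s < d \<Longrightarrow> \<Lambda> s r < e"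
proof -
  obtain d where d: "d > 0" "\<And>x y. x \<in> {0..T} \<Longrightarrow> y \<in> {0..T} \<Longrightarrow> \<bar>x - y\<bar> < d \<Longrightarrow> \<bar>\<Lambda> 0 x - \<Lambda> 0 y\<bar> < e"
    using uniformly_continuous_on_Icc_delta[OF continuous_on_LBINT_Icc[OF lam_int0[OF assms(1)]] assms(2)]
    by blast
  show ?thesis
  proof (rule that[OF d(1)])
    fix s r assume "0 \<le> s" "s \<le> r" "r \<le> T" "r - s < d"
    then show "\<Lambda> s r < e" using d(2)[of r s] \<Lambda>_add[of 0 s r] by auto
  qed
qed

lemmas trans_unfolded = trans[unfolded branching_transitions_def]

lemma P_compose: "0 \<le> s \<Longrightarrow> s \<le> t \<Longrightarrow> t \<le> u \<Longrightarrow> P s u n = bind_pmf (P s t n) (P t u)"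
  using trans_unfolded[THEN conjunct1, rule_format, of s t u n] by blast

lemma P_0: "0 \<le> s \<Longrightarrow> s \<le> t \<Longrightarrow> P s t 0 = return_pmf 0"
  and P_Suc: "0 \<le> s \<Longrightarrow> s \<le> t \<Longrightarrow>
    P s t (Suc n) = map_pmf (\<lambda>(i, j). i + j) (pair_pmf (P s t 1) (P s t n))"
  using trans_unfolded[THEN conjunct2, THEN conjunct1, rule_format, of s t] by blast+

lemma p_1: "0 \<le> t \<Longrightarrow> pmf (p t) 1 = 0"
  using trans_unfolded[THEN conjunct2, THEN conjunct2, THEN conjunct1] by blast

lemma leave_rate:
  assumes "\<epsilon> > 0"
  shows "\<exists>\<eta>>0. \<forall>s t. 0 \<le> s \<and> s \<le> t \<and> t \<le> T \<and> t - s \<le> \<eta> \<longrightarrow>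
    \<bar>(1 - pmf (P s t 1) 1) - \<Lambda> s t\<bar> \<le> \<epsilon> * \<Lambda> s t"
  using trans_unfolded[THEN conjunct2, THEN conjunct2, THEN conjunct2, THEN conjunct1, THEN spec, THEN spec, THEN mp, OF assms] .

lemma jump_rate:
  assumes "k \<noteq> 1" "\<epsilon> > 0"
  shows "\<exists>\<eta>>0. \<forall>s t. 0 \<le> s \<and> s \<le> t \<and> t \<le> T \<and> t - s \<le> \<eta> \<longrightarrow>
    \<bar>pmf (P s t 1) k - (LBINT u:{s..t}. lam u * pmf (p u) k)\<bar> \<le> \<epsilon> * \<Lambda> s t"
  using trans_unfolded[THEN conjunct2, THEN conjunct2, THEN conjunct2, THEN conjunct2, THEN spec, THEN spec, THEN spec, THEN mp, OF conjI[OF assms]] .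

lemma pgf_P:
  assumes "0 \<le> s" "s \<le> t" "v \<in> {0..1}"
  shows "pgf (P s t n) v = F s t v ^ n"
proof (induction n)
  case 0
  show ?case by (simp add: P_0[OF assms(1,2)])
next
  case (Suc n)
  then show ?case unfolding P_Suc[OF assms(1,2), of n] pgf_add_indep[OF assms(3)] by simp
qed

lemma F_in: "v \<in> {0..1} \<Longrightarrow> F s t v \<in> {0..1}"
  by (simp add: pgf_nonneg pgf_le_1)

lemma F_compose:
  assumes "0 \<le> s" "s \<le> t" "t \<le> u" "v \<in> {0..1}"
  shows "F s u v = F s t (F t u v)"
proof -
  have "pgf (bind_pmf (P s t 1) (P t u)) v = F s t (F t u v)"
    by (rule pgf_bind[OF assms(4) F_in[OF assms(4)]]) (rule pgf_P, use assms in auto)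
  then show ?thesis by (simp only: P_compose[OF assms(1-3), of 1])
qed

lemma pgf_offspring: "0 \<le> t \<Longrightarrow> v \<in> {0..1} \<Longrightarrow> pgf (p t) v = theta_pgf \<theta> (a t) v"
  by (rule sums_unique2[OF pgf_sums offspring])

text \<open>
A population is certainly back at its size if each of its individuals has exactly one descendant,
and these events are independent; the bound is Bernoulli's inequality.
\<close>

lemma leave_le:
  assumes "0 \<le> s" "s \<le> t"
  shows "1 - pmf (P s t n) n \<le> real n * (1 - pmf (P s t 1) 1)"
proof (induction n)
  case 0
  then show ?case by (simp add: P_0[OF assms])
next
  case (Suc n)
  let ?b = "pmf (P s t 1) 1" and ?c = "pmf (P s t n) n"
  have "?b * ?c \<le> pmf (P s t (Suc n)) (Suc n)"
    unfolding P_Suc[OF assms] using pmf_map_pair_ge[of "P s t 1" 1 "P s t n" n] by simp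
  moreover have "0 \<le> (1 - ?b) * (1 - ?c)" by (intro mult_nonneg_nonneg) (auto simp: pmf_le_1)
  ultimately show ?case using Suc.IH by (simp add: algebra_simps)
qed

lemma stay_mult:
  assumes "0 \<le> s" "s \<le> t" "t \<le> u"
  shows "pmf (P s t 1) 1 * pmf (P t u 1) 1 \<le> pmf (P s u 1) 1"
  using pmf_bind_ge[of "P s t 1" 1 "P t u" 1] by (simp only: P_compose[OF assms, of 1])

text \<open>
The infinitesimal rate holds with the factor 2 on short intervals. It extends to all intervals
because the probability of leaving size 1 is subadditive over adjacent intervals.
\<close>

lemma leave_le_rate:
  assumes "0 \<le> s" "s \<le> t"
  shows "1 - pmf (P s t 1) 1 \<le> 2 * \<Lambda> s t"
proof -
  obtain \<eta> where \<eta>: "\<eta> > 0" "\<forall>r u. 0 \<le> r \<and> r \<le> u \<and> u \<le> t \<and> u - r \<le> \<eta> \<longrightarrow>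
      \<bar>(1 - pmf (P r u 1) 1) - \<Lambda> r u\<bar> \<le> 1 * \<Lambda> r u"
    using leave_rate[OF zero_less_one, of t] by (elim exE conjE)
  define Q where "Q r u \<longleftrightarrow> (s \<le> r \<and> r \<le> u \<and> u \<le> t \<longrightarrow> 1 - pmf (P r u 1) 1 \<le> 2 * \<Lambda> r u)" for r u
  have "Q s t"
  proof (rule Bolzano[OF assms(2)])
    fix r u w assume Q: "Q r u" "Q u w" "r \<le> u" "u \<le> w"
    show "Q r w" unfolding Q_def
    proof
      assume A: "s \<le> r \<and> r \<le> w \<and> w \<le> t"
      let ?b = "pmf (P r u 1) 1" and ?c = "pmf (P u w 1) 1"
      have "0 \<le> (1 - ?b) * (1 - ?c)" by (intro mult_nonneg_nonneg) (auto simp: pmf_le_1)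
      then have "1 - ?b * ?c \<le> (1 - ?b) + (1 - ?c)" by (simp add: algebra_simps)
      then show "1 - pmf (P r w 1) 1 \<le> 2 * \<Lambda> r w"
        using stay_mult[of r u w] \<Lambda>_add[of r u w] Q A assms(1) unfolding Q_def by auto
    qed
  next
    fix x
    show "\<exists>d>0. \<forall>r u. r \<le> x \<and> x \<le> u \<and> u - r < d \<longrightarrow> Q r u"
    proof (intro exI[of _ \<eta>] conjI \<eta>(1) allI impI)
      fix r u assume "r \<le> x \<and> x \<le> u \<and> u - r < \<eta>"
      then show "Q r u" unfolding Q_def using \<eta>(2)[rule_format, of r u] assms(1) by (auto simp: abs_le_iff)
    qed
  qed
  then show ?thesis using assms by (simp add: Q_def)
qed

text \<open>
This will keep the solution of the backward equation away from 0, where its logarithm is singular.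
\<close>

lemma stay_pos:
  assumes "0 \<le> s" "s \<le> t"
  shows "0 < pmf (P s t 1) 1"
proof -
  obtain d where d: "d > 0" "\<And>s r. 0 \<le> s \<Longrightarrow> s \<le> r \<Longrightarrow> r \<le> t \<Longrightarrow> r - s < d \<Longrightarrow> \<Lambda> s r < 1 / 2"
    using \<Lambda>_small[of t "1/2"] assms by auto
  define Q where "Q r u \<longleftrightarrow> (s \<le> r \<and> r \<le> u \<and> u \<le> t \<longrightarrow> 0 < pmf (P r u 1) 1)" for r u
  have "Q s t"
  proof (rule Bolzano[OF assms(2)])
    fix r u w assume Q: "Q r u" "Q u w" "r \<le> u" "u \<le> w"
    show "Q r w" unfolding Q_def
    proof
      assume A: "s \<le> r \<and> r \<le> w \<and> w \<le> t"
      then have "0 < pmf (P r u 1) 1 * pmf (P u w 1) 1"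
        using Q unfolding Q_def by (intro mult_pos_pos) auto
      then show "0 < pmf (P r w 1) 1"
        using stay_mult[of r u w] Q A assms(1) by auto
    qed
  next
    fix x
    show "\<exists>d>0. \<forall>r u. r \<le> x \<and> x \<le> u \<and> u - r < d \<longrightarrow> Q r u"
    proof (intro exI[of _ d] conjI d(1) allI impI)
      fix r u assume "r \<le> x \<and> x \<le> u \<and> u - r < d"
      then show "Q r u" unfolding Q_def using d(2)[of r u] leave_le_rate[of r u] assms(1) by auto
    qed
  qed
  then show ?thesis using assms by (simp add: Q_def)
qed


section \<open>The offspring law and the infinitesimal generating function\<close>

text \<open>
The largest mean offspring number for which the generating function belongs to a probability law.
\<close>

definition max_offspring_mean :: real where "max_offspring_mean = 1 + 1 / \<theta>"

lemma max_offspring_mean_ge_2: "max_offspring_mean \<ge> 2"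
  using \<theta> by (simp add: max_offspring_mean_def)

lemma a_le_max_offspring_mean: "0 \<le> t \<Longrightarrow> \<bar>a t\<bar> \<le> max_offspring_mean"
  using a_bounds[of t] by (simp add: max_offspring_mean_def)

definition drift :: "real \<Rightarrow> real \<Rightarrow> real" where
  "drift \<alpha> y = (1 - \<alpha>) * y + \<alpha> / (1 + \<theta>) * y powr (1 + \<theta>)"

text \<open>
In terms of \<open>y = 1 - v\<close>, the right-hand side of the backward equation has no constant term.
\<close>

lemma theta_pgf_drift: "theta_pgf \<theta> \<alpha> (1 - y) - (1 - y) = drift \<alpha> y"
  unfolding theta_pgf_def drift_def by (simp add: algebra_simps)

lemma drift_lipschitz:
  assumes "0 \<le> \<alpha>" "\<alpha> \<le> max_offspring_mean" "x \<in> {0..1}" "y \<in> {0..1}"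
  shows "\<bar>drift \<alpha> x - drift \<alpha> y\<bar> \<le> 2 * max_offspring_mean * \<bar>x - y\<bar>"
proof -
  have "\<bar>1 - \<alpha>\<bar> \<le> max_offspring_mean" using assms max_offspring_mean_ge_2 by (auto simp: abs_le_iff)
  then have 1: "\<bar>(1 - \<alpha>) * (x - y)\<bar> \<le> max_offspring_mean * \<bar>x - y\<bar>"
    unfolding abs_mult by (intro mult_right_mono) auto
  have "\<bar>\<alpha> / (1 + \<theta>) * (x powr (1 + \<theta>) - y powr (1 + \<theta>))\<bar>
        = \<alpha> / (1 + \<theta>) * \<bar>x powr (1 + \<theta>) - y powr (1 + \<theta>)\<bar>"
    using assms \<theta> by (simp add: abs_mult)
  also have "\<dots> \<le> \<alpha> / (1 + \<theta>) * ((1 + \<theta>) * \<bar>x - y\<bar>)"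
    using assms \<theta> by (intro mult_left_mono powr_lipschitz_unit) auto
  also have "\<dots> = \<alpha> * \<bar>x - y\<bar>" using \<theta> by simp
  also have "\<dots> \<le> max_offspring_mean * \<bar>x - y\<bar>" using assms by (intro mult_right_mono) auto
  finally have 2: "\<bar>\<alpha> / (1 + \<theta>) * (x powr (1 + \<theta>) - y powr (1 + \<theta>))\<bar> \<le> max_offspring_mean * \<bar>x - y\<bar>" .
  have "drift \<alpha> x - drift \<alpha> y = (1 - \<alpha>) * (x - y) + \<alpha> / (1 + \<theta>) * (x powr (1 + \<theta>) - y powr (1 + \<theta>))"
    unfolding drift_def by (simp add: algebra_simps)
  then show ?thesis using 1 2 by linarith
qed

lemma drift_bound:
  assumes "0 \<le> \<alpha>" "\<alpha> \<le> max_offspring_mean" "y \<in> {0..1}"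
  shows "\<bar>drift \<alpha> y\<bar> \<le> 2 * max_offspring_mean"
proof -
  have "\<bar>drift \<alpha> y - drift \<alpha> 0\<bar> \<le> 2 * max_offspring_mean * \<bar>y - 0\<bar>" using assms by (intro drift_lipschitz) auto
  also have "\<dots> \<le> 2 * max_offspring_mean" using assms max_offspring_mean_ge_2 by (simp add: mult_left_le)
  finally show ?thesis by (simp add: drift_def)
qed

text \<open>
The offspring probabilities are affine functions of the mean \<open>a t\<close>, by comparing coefficients with
the binomial series. This is what makes them measurable in time.
\<close>

lemma offspring_prob:
  assumes t: "0 \<le> t"
  shows "pmf (p t) k = of_bool (k = 0)
    + a t * (of_bool (k = 1) - of_bool (k = 0) + ((1 + \<theta>) gchoose k) * (- 1) ^ k / (1 + \<theta>))"
    (is "_ = of_bool (k = 0) + a t * ?c k")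
proof -
  have "pmf (p t) k - (of_bool (k = 0) + a t * ?c k) = 0"
  proof (rule power_series_zero_coeffs)
    fix s :: real assume s: "s \<in> {0..<1}"
    have b: "(\<lambda>n. ((1 + \<theta>) gchoose n) * (- s) ^ n) sums (1 - s) powr (1 + \<theta>)"
      using gen_binomial_real[of "- s" "1 + \<theta>"] s by simp
    have b': "(\<lambda>n. ((1 + \<theta>) gchoose n) * (- 1) ^ n / (1 + \<theta>) * s ^ n) sums ((1 - s) powr (1 + \<theta>) / (1 + \<theta>))"
      using sums_divide[OF b, of "1 + \<theta>"] by (simp add: power_minus[of s] mult.assoc)
    have u: "(\<lambda>n. of_bool (n = i) * s ^ n) sums s ^ i" for i
      using sums_single[of i "\<lambda>n. s ^ n"] by (rule sums_cong[THEN iffD1, rotated]) auto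
    have "(\<lambda>n. (of_bool (n = 1) * s ^ n - of_bool (n = 0) * s ^ n
            + ((1 + \<theta>) gchoose n) * (- 1) ^ n / (1 + \<theta>) * s ^ n)) sums
          (s ^ 1 - s ^ 0 + (1 - s) powr (1 + \<theta>) / (1 + \<theta>))"
      by (intro sums_add sums_diff u b')
    from sums_add[OF u[of 0] sums_mult[OF this, of "a t"]]
    have "(\<lambda>n. of_bool (n = 0) * s ^ n + a t * (of_bool (n = 1) * s ^ n - of_bool (n = 0) * s ^ n
            + ((1 + \<theta>) gchoose n) * (- 1) ^ n / (1 + \<theta>) * s ^ n)) sums
          theta_pgf \<theta> (a t) s"
      by (simp add: theta_pgf_def algebra_simps)
    from sums_diff[OF offspring[OF t, of s] this] s
    show "(\<lambda>n. (pmf (p t) n - (of_bool (n = 0) + a t * ?c n)) * s ^ n) sums 0"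
      by (simp add: algebra_simps)
  qed
  then show ?thesis by simp
qed

text \<open>
Uniform tightness of the offspring laws: \<open>1 - theta_pgf \<theta> (a t) s\<close> is at most the bounded mean
times \<open>1 - s\<close>.
\<close>

lemma offspring_tail:
  assumes "\<epsilon> > 0"
  obtains K where "\<And>t. 0 \<le> t \<Longrightarrow> 1 - (\<Sum>k<K. pmf (p t) k) \<le> \<epsilon>"
proof -
  \<comment> \<open>The tail is at most \<open>(1 - pgf s) / (1 - s ^ K)\<close>; \<open>s\<close> makes the numerator at most \<open>\<epsilon> / 2\<close>, and
    \<open>K\<close> makes the denominator at least \<open>1 / 2\<close>.\<close>
  define s where "s = max 0 (1 - \<epsilon> / (2 * max_offspring_mean))"
  have max_offspring_mean0: "max_offspring_mean > 0" using max_offspring_mean_ge_2 by simp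
  have s: "0 \<le> s" "s < 1" "max_offspring_mean * (1 - s) \<le> \<epsilon> / 2"
    using assms max_offspring_mean0 unfolding s_def by (auto simp: max_def field_simps)
  obtain K where K: "s ^ K < 1 / 2" using real_arch_pow_inv[of "1/2" s] s by auto
  show ?thesis
  proof (rule that[of K])
    fix t :: real assume t: "0 \<le> t"
    have "0 \<le> a t / (1 + \<theta>) * (1 - s) powr (1 + \<theta>)" using a_bounds[OF t] \<theta> by simp
    then have "1 - pgf (p t) s \<le> a t * (1 - s)"
      using pgf_offspring[OF t, of s] s by (simp add: theta_pgf_def)
    also have "\<dots> \<le> max_offspring_mean * (1 - s)"
      using a_bounds[OF t] s by (intro mult_right_mono) (auto simp: max_offspring_mean_def)
    finally have 1: "1 - pgf (p t) s \<le> \<epsilon> / 2" using s by simp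
    have "(1 - (\<Sum>k<K. pmf (p t) k)) * (1 / 2) \<le> (1 - (\<Sum>k<K. pmf (p t) k)) * (1 - s ^ K)"
      using K sum_pmf_le_1[of "p t" K] by (intro mult_left_mono) auto
    also have "\<dots> \<le> 1 - pgf (p t) s" using s by (intro pgf_tail_bound) auto
    finally show "1 - (\<Sum>k<K. pmf (p t) k) \<le> \<epsilon>" using 1 by simp
  qed
qed

lemma lam_a_int: "0 \<le> s \<Longrightarrow> set_integrable lborel {s..t} (\<lambda>u. lam u * a u)"
proof (rule set_integrable_mult_bounded[OF lam_int])
  assume s: "0 \<le> s"
  show "set_borel_measurable lborel {s..t} a"
    by (rule set_borel_measurable_subset[OF a_meas]) (use s in auto)
  show "\<bar>a u\<bar> \<le> max_offspring_mean" if "u \<in> {s..t}" for u using that s by (intro a_le_max_offspring_mean) auto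
qed

lemma lam_offspring_int: 
  assumes "0 \<le> s"
  shows "set_integrable lborel {s..t} (\<lambda>u. lam u * pmf (p u) k)"
proof -
  let ?c = "of_bool (k = 1) - of_bool (k = 0) + ((1 + \<theta>) gchoose k) * (- 1) ^ k / (1 + \<theta>)"
  have "set_integrable lborel {s..t} (\<lambda>u. lam u * of_bool (k = 0) + lam u * a u * ?c)"
    using assms by (intro set_integral_add set_integrable_mult_left lam_int lam_a_int)
  also have "?this \<longleftrightarrow> ?thesis"
  proof (intro set_integrable_cong refl)
    fix u assume "u \<in> {s..t}"
    then have "pmf (p u) k = of_bool (k = 0) + a u * ?c"
      using assms by (intro offspring_prob) auto
    then show "lam u * of_bool (k = 0) + lam u * a u * ?c = lam u * pmf (p u) k"
      by (simp only: distrib_left mult.assoc)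
  qed
  finally show ?thesis .
qed

lemma lam_drift_int:
  assumes "0 \<le> s" "continuous_on {s..t} y" "\<And>u. u \<in> {s..t} \<Longrightarrow> 0 \<le> y u"
  shows "set_integrable lborel {s..t} (\<lambda>u. lam u * drift (a u) (y u))"
proof -
  have "continuous_on {s..t} (\<lambda>u. y u powr (1 + \<theta>))"
    using assms \<theta> by (intro continuous_on_powr' assms continuous_intros) auto
  then have "continuous_on {s..t} (\<lambda>u. y u powr (1 + \<theta>) / (1 + \<theta>) - y u)"
    using assms(2) \<theta> by (intro continuous_on_diff continuous_on_divide continuous_on_const) auto
  then have "set_integrable lborel {s..t}
      (\<lambda>u. lam u * y u + (lam u * a u) * (y u powr (1 + \<theta>) / (1 + \<theta>) - y u))"
    by (intro set_integral_add(1) set_integrable_mult_continuous[OF lam_int[OF assms(1)]]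
          set_integrable_mult_continuous[OF lam_a_int[OF assms(1)]] assms(2))
  then show ?thesis by (simp add: drift_def algebra_simps)
qed

lemma LBINT_lam_le:
  assumes s: "0 \<le> s" and int: "set_integrable lborel {s..t} (\<lambda>u. lam u * g u)"
    and "\<And>u. u \<in> {s..t} \<Longrightarrow> \<bar>g u\<bar> \<le> B"
  shows "\<bar>LBINT u:{s..t}. lam u * g u\<bar> \<le> B * \<Lambda> s t"
proof -
  have "(LBINT u:{s..t}. \<bar>lam u\<bar>) = \<Lambda> s t"
    using s lam_nonneg by (intro set_lebesgue_integral_cong) auto
  with LBINT_mult_bound[OF lam_int[OF s] int assms(3)] show ?thesis by simp
qed

lemma jump_rate_uniform:
  fixes T :: real
  assumes I: "finite I" "1 \<notin> I" and e: "\<epsilon> > 0"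
  shows "\<exists>\<eta>>0. \<forall>k\<in>I. \<forall>s t. 0 \<le> s \<and> s \<le> t \<and> t \<le> T \<and> t - s \<le> \<eta> \<longrightarrow>
    \<bar>pmf (P s t 1) k - (LBINT u:{s..t}. lam u * pmf (p u) k)\<bar> \<le> \<epsilon> * \<Lambda> s t"
  using I
proof (induction I rule: finite_induct)
  case empty
  then show ?case by (auto intro: exI[of _ 1])
next
  case (insert k I)
  obtain \<eta>1 where \<eta>1: "\<eta>1 > 0" "\<forall>s t. 0 \<le> s \<and> s \<le> t \<and> t \<le> T \<and> t - s \<le> \<eta>1 \<longrightarrow>
    \<bar>pmf (P s t 1) k - (LBINT u:{s..t}. lam u * pmf (p u) k)\<bar> \<le> \<epsilon> * \<Lambda> s t"
    using jump_rate[of k \<epsilon> T] insert.prems e by (elim exE conjE meta_impE) auto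
  obtain \<eta>2 where \<eta>2: "\<eta>2 > 0" "\<forall>k\<in>I. \<forall>s t. 0 \<le> s \<and> s \<le> t \<and> t \<le> T \<and> t - s \<le> \<eta>2 \<longrightarrow>
    \<bar>pmf (P s t 1) k - (LBINT u:{s..t}. lam u * pmf (p u) k)\<bar> \<le> \<epsilon> * \<Lambda> s t"
    using insert.IH insert.prems by (elim exE conjE meta_impE) auto
  show ?case
    by (rule exI[of _ "min \<eta>1 \<eta>2"]) (use \<eta>1 \<eta>2 in auto)
qed

text \<open>
The infinitesimal description of one individual, in terms of generating functions. Sizes \<open>k < K\<close> are
controlled one by one. The probability of the remaining sizes need not be estimated directly: it
is what is missing to the probability of leaving size 1, hence it is close to its integrated rate,
which is small by tightness.
\<close>

lemma pgf_infinitesimal: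
  fixes T :: real
  assumes e: "\<epsilon> > 0"
  shows "\<exists>\<eta>>0. \<forall>s r v. 0 \<le> s \<and> s \<le> r \<and> r \<le> T \<and> r - s \<le> \<eta> \<and> v \<in> {0..1} \<longrightarrow>
    \<bar>F s r v - v - (LBINT u:{s..r}. lam u * (theta_pgf \<theta> (a u) v - v))\<bar> \<le> \<epsilon> * \<Lambda> s r"
proof -
  define e1 where "e1 = \<epsilon> / 5"
  have e1: "e1 > 0" using e by (simp add: e1_def)
  obtain K0 where K0: "\<And>t. 0 \<le> t \<Longrightarrow> 1 - (\<Sum>k<K0. pmf (p t) k) \<le> e1"
    using offspring_tail[OF e1] by blast
  \<comment> \<open>At least 2, so that size 1, which is described by the probability of leaving it, is among the
    sizes below \<open>K\<close> and can be split off.\<close>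
  define K where "K = K0 + 2"
  have tail: "1 - (\<Sum>k<K. pmf (p t) k) \<le> e1" if "0 \<le> t" for t
  proof -
    have "(\<Sum>k<K0. pmf (p t) k) \<le> (\<Sum>k<K. pmf (p t) k)"
      by (intro sum_mono2) (auto simp: K_def)
    with K0[OF that] show ?thesis by simp
  qed
  define I where "I = {..<K} - {1::nat}"
  have I: "finite I" "1 \<notin> I" "{..<K} = insert 1 I" unfolding I_def K_def by auto
  \<comment> \<open>The errors of the sizes below \<open>K\<close> are added up, so each gets a share of \<open>e1\<close>.\<close>
  define e2 where "e2 = e1 / (real (card I) + 1)"
  have e2: "e2 > 0" "e2 \<le> e1" "real (card I) * e2 \<le> e1"
    using e1 unfolding e2_def by (auto simp: field_simps)
  obtain \<eta>1 where \<eta>1: "\<eta>1 > 0" "\<forall>k\<in>I. \<forall>s t. 0 \<le> s \<and> s \<le> t \<and> t \<le> T \<and> t - s \<le> \<eta>1 \<longrightarrow>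
    \<bar>pmf (P s t 1) k - (LBINT u:{s..t}. lam u * pmf (p u) k)\<bar> \<le> e2 * \<Lambda> s t"
    using jump_rate_uniform[OF I(1,2) e2(1), of T] by (elim exE conjE) 
  obtain \<eta>2 where \<eta>2: "\<eta>2 > 0" "\<forall>s t. 0 \<le> s \<and> s \<le> t \<and> t \<le> T \<and> t - s \<le> \<eta>2 \<longrightarrow>
        \<bar>(1 - pmf (P s t 1) 1) - \<Lambda> s t\<bar> \<le> e2 * \<Lambda> s t"
    using leave_rate[OF e2(1), of T] by (elim exE conjE)
  show ?thesis
  proof (intro exI[of _ "min \<eta>1 \<eta>2"] conjI allI impI)
    show "min \<eta>1 \<eta>2 > 0" using \<eta>1 \<eta>2 by simp
    fix s r v :: real
    assume asm: "0 \<le> s \<and> s \<le> r \<and> r \<le> T \<and> r - s \<le> min \<eta>1 \<eta>2 \<and> v \<in> {0..1}"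
    then have s: "0 \<le> s" "s \<le> r" and v: "v \<in> {0..1}" by auto
    define D where "D = \<Lambda> s r"
    have D: "D \<ge> 0" unfolding D_def using s by (intro \<Lambda>_nonneg)
    define q where "q k = pmf (P s r 1) k" for k
    define i where "i k = (LBINT u:{s..r}. lam u * pmf (p u) k)" for k
    have qi: "\<bar>q k - i k\<bar> \<le> e2 * D" if "k \<in> I" for k
      using \<eta>1(2)[rule_format, OF that, of s r] asm unfolding q_def i_def D_def by auto
    have q1: "\<bar>(1 - q 1) - D\<bar> \<le> e2 * D"
      using \<eta>2(2)[rule_format, of s r] asm unfolding q_def D_def by auto
    have vk: "v ^ k \<in> {0..1}" for k using v by (auto intro: power_le_one)
    have diff: "\<bar>(\<Sum>k\<in>I. q k * w k) - (\<Sum>k\<in>I. i k * w k)\<bar> \<le> e1 * D"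
      if w: "\<And>k. w k \<in> {0..1::real}" for w
    proof -
      have "\<bar>(\<Sum>k\<in>I. q k * w k) - (\<Sum>k\<in>I. i k * w k)\<bar> = \<bar>\<Sum>k\<in>I. (q k - i k) * w k\<bar>"
        by (simp add: sum_subtractf left_diff_distrib)
      also have "\<dots> \<le> (\<Sum>k\<in>I. \<bar>(q k - i k) * w k\<bar>)" by (rule sum_abs)
      also have "\<dots> \<le> (\<Sum>k\<in>I. e2 * D)"
      proof (rule sum_mono)
        fix k assume k: "k \<in> I"
        have "\<bar>(q k - i k) * w k\<bar> \<le> \<bar>q k - i k\<bar>"
          using w[of k] by (simp add: abs_mult mult_left_le)
        with qi[OF k] show "\<bar>(q k - i k) * w k\<bar> \<le> e2 * D" by simp
      qed
      also have "\<dots> = (real (card I) * e2) * D" by simp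
      also have "\<dots> \<le> e1 * D" using e2 D by (intro mult_right_mono) auto
      finally show ?thesis .
    qed
    define A B A1 B1 where AB: "A = (\<Sum>k\<in>I. q k * v ^ k)" "B = (\<Sum>k\<in>I. i k * v ^ k)"
      "A1 = (\<Sum>k\<in>I. q k)" "B1 = (\<Sum>k\<in>I. i k)"
    have dAB: "\<bar>A - B\<bar> \<le> e1 * D" "\<bar>A1 - B1\<bar> \<le> e1 * D"
      unfolding AB using diff[of "\<lambda>k. v ^ k"] diff[of "\<lambda>k. 1"] vk by auto
    \<comment> \<open>The truncation error of \<open>F\<close> is at most \<open>1 - A1 - q 1\<close>, and that of its rate \<open>J\<close> at most
      \<open>D - B1\<close>; the former is close to the latter, which is small.\<close>
    have F: "A + q 1 * v \<le> F s r v" "F s r v \<le> A + q 1 * v + (1 - A1 - q 1)"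
      using pgf_partial_sum_le[OF v, of "P s r 1" K] pgf_le_partial_sum[OF v, of "P s r 1" K] I
      by (simp_all add: AB q_def)
    define J where "J = (LBINT u:{s..r}. lam u * theta_pgf \<theta> (a u) v)"
    have cv: "continuous_on {s..r} (\<lambda>u. 1 - v)" by (intro continuous_intros)
    have intd: "set_integrable lborel {s..r} (\<lambda>u. lam u * (theta_pgf \<theta> (a u) v - v))"
      using lam_drift_int[OF s(1) cv] v theta_pgf_drift[of _ "1 - v"] by simp
    have intv: "set_integrable lborel {s..r} (\<lambda>u. lam u * v)"
      using lam_int[OF s(1)] by simp
    have intJ: "set_integrable lborel {s..r} (\<lambda>u. lam u * theta_pgf \<theta> (a u) v)"
      using set_integral_add(1)[OF intd intv]
      by (simp add: algebra_simps)
    have J: "(LBINT u:{s..r}. lam u * (theta_pgf \<theta> (a u) v - v)) = J - D * v"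
      unfolding J_def D_def right_diff_distrib
      using set_integral_diff(2)[OF intJ intv] by simp
    have intk: "set_integrable lborel {s..r} (\<lambda>u. lam u * pmf (p u) k * w)" for k w
      by (intro set_integrable_mult_left lam_offspring_int s)
    have intS: "set_integrable lborel {s..r} (\<lambda>u. \<Sum>k\<in>I. lam u * pmf (p u) k * w k)"
      "(LBINT u:{s..r}. (\<Sum>k\<in>I. lam u * pmf (p u) k * w k)) = (\<Sum>k\<in>I. i k * w k)" for w
      using LINT_sum[of I lborel "{s..r}" "\<lambda>k u. lam u * pmf (p u) k * w k"] intk
      by (simp_all add: i_def)
    have part: "(\<Sum>k<K. pmf (p u) k * w k) = (\<Sum>k\<in>I. pmf (p u) k * w k)" if "u \<in> {s..r}" for u w
      using I p_1[of u] that s by simp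
    have B: "B \<le> J"
      unfolding AB J_def intS(2)[of "\<lambda>k. v ^ k", symmetric]
    proof (intro set_integral_mono intS intJ)
      fix u assume u: "u \<in> {s..r}"
      then have "lam u * (\<Sum>k\<in>I. pmf (p u) k * v ^ k) \<le> lam u * theta_pgf \<theta> (a u) v"
        using pgf_partial_sum_le[OF v, of "p u" K] part[OF u] pgf_offspring[of u v] v s lam_nonneg[of u]
        by (intro mult_left_mono) auto
      then show "(\<Sum>k\<in>I. lam u * pmf (p u) k * v ^ k) \<le> lam u * theta_pgf \<theta> (a u) v"
        by (simp add: sum_distrib_left mult.assoc)
    qed
    have "J \<le> (LBINT u:{s..r}. (\<Sum>k\<in>I. lam u * pmf (p u) k * v ^ k)
        + (lam u - (\<Sum>k\<in>I. lam u * pmf (p u) k * 1)))"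
      unfolding J_def
    proof (intro set_integral_mono intS intJ set_integral_add(1) set_integral_diff(1) lam_int s)
      fix u assume u: "u \<in> {s..r}"
      then have "lam u * theta_pgf \<theta> (a u) v
          \<le> lam u * ((\<Sum>k\<in>I. pmf (p u) k * v ^ k) + (1 - (\<Sum>k\<in>I. pmf (p u) k * 1)))"
        using pgf_le_partial_sum[OF v, of "p u" K] part[OF u, of "\<lambda>k. v ^ k"] part[OF u, of "\<lambda>k. 1"]
          pgf_offspring[of u v] v s lam_nonneg[of u]
        by (intro mult_left_mono) auto
      then show "lam u * theta_pgf \<theta> (a u) v \<le> (\<Sum>k\<in>I. lam u * pmf (p u) k * v ^ k)
        + (lam u - (\<Sum>k\<in>I. lam u * pmf (p u) k * 1))"
        by (simp add: sum_distrib_left mult.assoc algebra_simps)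
    qed
    also have "\<dots> = B + (D - B1)"
      using intS[of "\<lambda>k. v ^ k"] intS[of "\<lambda>k. 1"] lam_int[OF s(1), of r]
      by (simp add: set_integral_add set_integral_diff AB D_def)
    finally have J2: "J \<le> B + (D - B1)" .
    have "D - B1 = (LBINT u:{s..r}. lam u - (\<Sum>k\<in>I. lam u * pmf (p u) k * 1))"
      using intS[of "\<lambda>k. 1"] lam_int[OF s(1), of r]
      by (simp add: set_integral_diff AB D_def)
    also have "\<dots> \<le> (LBINT u:{s..r}. lam u * e1)"
    proof (intro set_integral_mono intS set_integral_diff(1) lam_int s set_integrable_mult_left)
      fix u assume u: "u \<in> {s..r}"
      then have "lam u * (1 - (\<Sum>k\<in>I. pmf (p u) k * 1)) \<le> lam u * e1"
        using tail[of u] part[OF u, of "\<lambda>k. 1"] s lam_nonneg[of u] by (intro mult_left_mono) auto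
      then show "lam u - (\<Sum>k\<in>I. lam u * pmf (p u) k * 1) \<le> lam u * e1"
        by (simp add: sum_distrib_left mult.assoc algebra_simps)
    qed
    also have "\<dots> = e1 * D" by (simp add: D_def)
    finally have tD: "D - B1 \<le> e1 * D" .
    have e21: "e2 * D \<le> e1 * D" using e2 D by (intro mult_right_mono) auto
    have qv: "\<bar>v * ((1 - q 1) - D)\<bar> \<le> e1 * D"
    proof -
      have "\<bar>v * ((1 - q 1) - D)\<bar> \<le> \<bar>(1 - q 1) - D\<bar>"
        using v by (simp add: abs_mult mult_left_le_one_le)
      then show ?thesis using q1 e21 by linarith
    qed
    have "F s r v - v - (J - D * v) \<le> 5 * (e1 * D)" "- (5 * (e1 * D)) \<le> F s r v - v - (J - D * v)"
      using F B J2 tD qv q1 e21 dAB by (simp_all add: algebra_simps abs_le_iff)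
    then show "\<bar>F s r v - v - (LBINT u:{s..r}. lam u * (theta_pgf \<theta> (a u) v - v))\<bar> \<le> \<epsilon> * \<Lambda> s r"
      unfolding J D_def[symmetric] by (simp add: e1_def abs_le_iff)
  qed
qed


section \<open>The backward equation and its explicit solution\<close>

text \<open>
One individual is still one individual after an interval of length 0, because the integrated rate
vanishes there.
\<close>

lemma F_refl:
  assumes t: "0 \<le> t" and v: "v \<in> {0..1}"
  shows "F t t v = v"
proof -
  have "pmf (P t t 1) 1 = 1" using leave_le_rate[of t t] t pmf_le_1[of "P t t 1" 1] by simp
  moreover have "pmf (P t t 1) 0 + pmf (P t t 1) 1 \<le> 1"
    using sum_pmf_le_1[of "P t t 1" 2] by (simp add: eval_nat_numeral)
  ultimately have "pmf (P t t 1) 1 = 1" "pmf (P t t 1) 0 = 0" using pmf_nonneg[of "P t t 1" 0] by linarith+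
  then show ?thesis
    using pgf_partial_sum_le[OF v, of "P t t 1" 2] pgf_le_partial_sum[OF v, of "P t t 1" 2]
    by (simp add: eval_nat_numeral)
qed

context
  fixes t v :: real
  assumes t: "0 \<le> t" and v: "v \<in> {0..1}"
begin

text \<open>
If every individual alive at time \<open>t\<close> is marked independently with probability \<open>1 - v\<close>, this is the
probability that an individual alive at time \<open>s\<close> has a marked descendant.
\<close>

definition marked_prob :: "real \<Rightarrow> real" where "marked_prob s = 1 - F s t v"

lemma marked_prob_in: "marked_prob s \<in> {0..1}"
  unfolding marked_prob_def using F_in[OF v] by simp

text \<open>
By the composition rule \<open>F s t v = F s r (F r t v)\<close>, the increment over \<open>[s, r]\<close> is the
infinitesimal change of the identity under \<open>F s r\<close>, taken at the point \<open>F r t v\<close>.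
\<close>

lemma marked_prob_increment:
  assumes e: "\<epsilon> > 0"
  shows "\<exists>\<eta>>0. \<forall>s r. 0 \<le> s \<and> s \<le> r \<and> r \<le> t \<and> r - s \<le> \<eta> \<longrightarrow>
    \<bar>marked_prob r - marked_prob s - (LBINT u:{s..r}. lam u * drift (a u) (marked_prob r))\<bar> \<le> \<epsilon> * \<Lambda> s r"
proof -
  obtain \<eta> where \<eta>: "\<eta> > 0" "\<forall>s r w. 0 \<le> s \<and> s \<le> r \<and> r \<le> t \<and> r - s \<le> \<eta> \<and> w \<in> {0..1} \<longrightarrow>
    \<bar>F s r w - w - (LBINT u:{s..r}. lam u * (theta_pgf \<theta> (a u) w - w))\<bar> \<le> \<epsilon> * \<Lambda> s r"
    using pgf_infinitesimal[OF e, of t] by (elim exE conjE)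
  show ?thesis
  proof (intro exI[of _ \<eta>] conjI \<eta>(1) allI impI)
    fix s r assume A: "0 \<le> s \<and> s \<le> r \<and> r \<le> t \<and> r - s \<le> \<eta>"
    have "F s t v = F s r (F r t v)" using A v by (intro F_compose) auto
    then have "F s r (1 - marked_prob r) - (1 - marked_prob r) = marked_prob r - marked_prob s" by (simp add: marked_prob_def)
    moreover have "1 - marked_prob r \<in> {0..1}" using marked_prob_in[of r] by auto
    ultimately show "\<bar>marked_prob r - marked_prob s - (LBINT u:{s..r}. lam u * drift (a u) (marked_prob r))\<bar> \<le> \<epsilon> * \<Lambda> s r"
      using \<eta>(2)[rule_format, of s r "1 - marked_prob r"] A by (simp add: theta_pgf_drift)
  qed
qed

lemma marked_prob_increment_bound:
  "\<exists>\<eta>>0. \<forall>s r. 0 \<le> s \<and> s \<le> r \<and> r \<le> t \<and> r - s \<le> \<eta> \<longrightarrow> \<bar>marked_prob r - marked_prob s\<bar> \<le> (1 + 2 * max_offspring_mean) * \<Lambda> s r"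
proof -
  obtain \<eta> where \<eta>: "\<eta> > 0" "\<forall>s r. 0 \<le> s \<and> s \<le> r \<and> r \<le> t \<and> r - s \<le> \<eta> \<longrightarrow>
    \<bar>marked_prob r - marked_prob s - (LBINT u:{s..r}. lam u * drift (a u) (marked_prob r))\<bar> \<le> 1 * \<Lambda> s r"
    using marked_prob_increment[OF zero_less_one] by (elim exE conjE)
  show ?thesis
  proof (intro exI[of _ \<eta>] conjI \<eta>(1) allI impI)
    fix s r assume A: "0 \<le> s \<and> s \<le> r \<and> r \<le> t \<and> r - s \<le> \<eta>"
    have "\<bar>LBINT u:{s..r}. lam u * drift (a u) (marked_prob r)\<bar> \<le> 2 * max_offspring_mean * \<Lambda> s r"
      using A marked_prob_in[of r] a_bounds
      by (intro LBINT_lam_le lam_drift_int drift_bound) (auto simp: max_offspring_mean_def)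
    then show "\<bar>marked_prob r - marked_prob s\<bar> \<le> (1 + 2 * max_offspring_mean) * \<Lambda> s r"
      using \<eta>(2)[rule_format, of s r] A by (simp add: algebra_simps abs_le_iff)
  qed
qed

lemma marked_prob_small_increment:
  assumes e: "e > 0"
  obtains d where "d > 0" "\<And>s r. 0 \<le> s \<Longrightarrow> s \<le> r \<Longrightarrow> r \<le> t \<Longrightarrow> r - s < d \<Longrightarrow> \<bar>marked_prob r - marked_prob s\<bar> < e"
proof -
  obtain \<eta> where \<eta>: "\<eta> > 0" "\<forall>s r. 0 \<le> s \<and> s \<le> r \<and> r \<le> t \<and> r - s \<le> \<eta> \<longrightarrow>
      \<bar>marked_prob r - marked_prob s\<bar> \<le> (1 + 2 * max_offspring_mean) * \<Lambda> s r"
    using marked_prob_increment_bound by (elim exE conjE)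
  have c: "1 + 2 * max_offspring_mean > 0" using max_offspring_mean_ge_2 by simp
  then have "e / (1 + 2 * max_offspring_mean) > 0" using e by simp
  then obtain d where d: "d > 0" "\<And>s r. 0 \<le> s \<Longrightarrow> s \<le> r \<Longrightarrow> r \<le> t \<Longrightarrow> r - s < d \<Longrightarrow> \<Lambda> s r < e / (1 + 2 * max_offspring_mean)"
    using \<Lambda>_small[OF t] by blast
  show ?thesis
  proof (rule that[of "min d \<eta>"])
    show "min d \<eta> > 0" using d \<eta> by simp
    fix s r assume A: "0 \<le> s" "s \<le> r" "r \<le> t" "r - s < min d \<eta>"
    have "\<bar>marked_prob r - marked_prob s\<bar> \<le> (1 + 2 * max_offspring_mean) * \<Lambda> s r" using \<eta>(2)[rule_format, of s r] A by auto
    also have "\<dots> < (1 + 2 * max_offspring_mean) * (e / (1 + 2 * max_offspring_mean))"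
      using c d(2)[of s r] A by (intro mult_strict_left_mono) auto
    also have "\<dots> = e" using c by simp
    finally show "\<bar>marked_prob r - marked_prob s\<bar> < e" .
  qed
qed

lemma marked_prob_continuous: "continuous_on {0..t} marked_prob"
  unfolding continuous_on_iff
proof (intro ballI allI impI)
  fix x e :: real assume x: "x \<in> {0..t}" and e: "0 < e"
  obtain d where d: "d > 0" "\<And>s r. 0 \<le> s \<Longrightarrow> s \<le> r \<Longrightarrow> r \<le> t \<Longrightarrow> r - s < d \<Longrightarrow> \<bar>marked_prob r - marked_prob s\<bar> < e"
    using marked_prob_small_increment[OF e] by blast
  show "\<exists>d>0. \<forall>x'\<in>{0..t}. dist x' x < d \<longrightarrow> dist (marked_prob x') (marked_prob x) < e"
  proof (intro exI[of _ d] conjI d(1) ballI impI)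
    fix x' assume x': "x' \<in> {0..t}" "dist x' x < d"
    show "dist (marked_prob x') (marked_prob x) < e"
    proof (cases "x \<le> x'")
      case True
      then show ?thesis using d(2)[of x x'] x x' by (auto simp: dist_real_def)
    next
      case False
      then show ?thesis using d(2)[of x' x] x x' by (auto simp: dist_real_def)
    qed
  qed
qed

lemma lam_drift_marked_prob_int: "set_integrable lborel {0..t} (\<lambda>u. lam u * drift (a u) (marked_prob u))"
  using marked_prob_continuous marked_prob_in by (intro lam_drift_int) auto

text \<open>
The infinitesimal increments come with the integrand frozen at the right end point \<open>r\<close>; the
Lipschitz continuity of the drift and the continuity of \<open>marked_prob\<close> allow it to vary.
\<close>

lemma backward_equation:
  assumes r: "r \<in> {0..t}"
  shows "marked_prob r = marked_prob 0 + (LBINT u:{0..r}. lam u * drift (a u) (marked_prob u))"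
proof -
  define Q where "Q r = marked_prob r - (LBINT u:{0..r}. lam u * drift (a u) (marked_prob u))" for r
  have "Q r = Q 0"
  proof (rule constant_if_increments_negligible[where f=Q and a=0 and b=r and G="\<lambda>r. \<Lambda> 0 r"])
    show "0 \<le> r" using r by simp
    fix \<epsilon> :: real assume e: "\<epsilon> > 0"
    obtain \<eta> where \<eta>: "\<eta> > 0" "\<forall>s r. 0 \<le> s \<and> s \<le> r \<and> r \<le> t \<and> r - s \<le> \<eta> \<longrightarrow>
      \<bar>marked_prob r - marked_prob s - (LBINT u:{s..r}. lam u * drift (a u) (marked_prob r))\<bar> \<le> \<epsilon> / 2 * \<Lambda> s r"
      using marked_prob_increment[OF half_gt_zero[OF e]] by (elim exE conjE)
    have c: "max_offspring_mean > 0" using max_offspring_mean_ge_2 by simp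
    then have "\<epsilon> / (4 * max_offspring_mean) > 0" using e by simp
    then obtain d where d: "d > 0"
      "\<And>s r. 0 \<le> s \<Longrightarrow> s \<le> r \<Longrightarrow> r \<le> t \<Longrightarrow> r - s < d \<Longrightarrow> \<bar>marked_prob r - marked_prob s\<bar> < \<epsilon> / (4 * max_offspring_mean)"
      using marked_prob_small_increment by blast
    show "\<exists>\<eta>>0. \<forall>s q. 0 \<le> s \<and> s \<le> q \<and> q \<le> r \<and> q - s < \<eta> \<longrightarrow> \<bar>Q q - Q s\<bar> \<le> \<epsilon> * (\<Lambda> 0 q - \<Lambda> 0 s)"
    proof (intro exI[of _ "min d \<eta>"] conjI allI impI)
      show "min d \<eta> > 0" using d \<eta> by simp
      fix s q assume A0: "0 \<le> s \<and> s \<le> q \<and> q \<le> r \<and> q - s < min d \<eta>"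
      then have A: "0 \<le> s" "s \<le> q" "q \<le> t" "q - s < d" "q - s < \<eta>" using r by auto
      have i1: "set_integrable lborel {s..q} (\<lambda>u. lam u * drift (a u) (marked_prob q))"
        using A marked_prob_in[of q] by (intro lam_drift_int) auto
      have i2: "set_integrable lborel {s..q} (\<lambda>u. lam u * drift (a u) (marked_prob u))"
        using A by (intro set_integrable_Icc_subset[OF lam_drift_marked_prob_int]) auto
      have i3: "set_integrable lborel {s..q} (\<lambda>u. lam u * (drift (a u) (marked_prob q) - drift (a u) (marked_prob u)))"
        using set_integral_diff(1)[OF i1 i2] by (simp add: right_diff_distrib)
      have eq: "Q q - Q s = (marked_prob q - marked_prob s - (LBINT u:{s..q}. lam u * drift (a u) (marked_prob q)))
          + (LBINT u:{s..q}. lam u * (drift (a u) (marked_prob q) - drift (a u) (marked_prob u)))"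
        unfolding Q_def using LBINT_Icc_diff[OF lam_drift_marked_prob_int, of s q] A set_integral_diff(2)[OF i1 i2]
        by (simp add: right_diff_distrib)
      have b1: "\<bar>marked_prob q - marked_prob s - (LBINT u:{s..q}. lam u * drift (a u) (marked_prob q))\<bar> \<le> \<epsilon> / 2 * \<Lambda> s q"
        using \<eta>(2)[rule_format, of s q] A by auto
      have b2: "\<bar>LBINT u:{s..q}. lam u * (drift (a u) (marked_prob q) - drift (a u) (marked_prob u))\<bar> \<le> \<epsilon> / 2 * \<Lambda> s q"
      proof (rule LBINT_lam_le[OF A(1) i3])
        fix u assume u: "u \<in> {s..q}"
        have "\<bar>drift (a u) (marked_prob q) - drift (a u) (marked_prob u)\<bar> \<le> 2 * max_offspring_mean * \<bar>marked_prob q - marked_prob u\<bar>"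
          using u A a_bounds[of u] marked_prob_in by (intro drift_lipschitz) (auto simp: max_offspring_mean_def)
        also have "\<dots> \<le> 2 * max_offspring_mean * (\<epsilon> / (4 * max_offspring_mean))"
          using d(2)[of u q] u A c by (intro mult_left_mono) auto
        also have "\<dots> = \<epsilon> / 2" using c by simp
        finally show "\<bar>drift (a u) (marked_prob q) - drift (a u) (marked_prob u)\<bar> \<le> \<epsilon> / 2" .
      qed
      have "\<bar>Q q - Q s\<bar> \<le> \<epsilon> * \<Lambda> s q" unfolding eq using b1 b2 by linarith
      then show "\<bar>Q q - Q s\<bar> \<le> \<epsilon> * (\<Lambda> 0 q - \<Lambda> 0 s)" using \<Lambda>_add[of 0 s q] A by simp
    qed
  qed
  then show ?thesis by (simp add: Q_def)
qed

end

text \<open>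
The logarithm of the expected population size, as \<open>mean_population\<close> below confirms.
\<close>

definition log_mean :: "real \<Rightarrow> real" where
  "log_mean t = (LBINT u:{0..t}. lam u * (a u - 1))"

definition mean :: "real \<Rightarrow> real" where
  "mean t = exp (log_mean t)"

definition V :: "real \<Rightarrow> real" where
  "V t = \<theta> / (1 + \<theta>) * (LBINT u:{0..t}. mean u powr (-\<theta>) * lam u)"

lemma log_mean_0: "log_mean 0 = 0"
  by (simp add: log_mean_def)

lemma mean_pos: "0 < mean t"
  by (simp add: mean_def)

lemma mean_powr: "mean t powr (-\<theta>) = exp (- \<theta> * log_mean t)"
  by (simp add: mean_def powr_def)

lemma lam_growth_int: "set_integrable lborel {0..t} (\<lambda>u. lam u * (a u - 1))"
  using set_integral_diff(1)[OF lam_a_int[of 0 t] lam_int[of 0 t]] by (simp add: right_diff_distrib)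

lemma log_mean_continuous: "continuous_on {0..t} log_mean"
  unfolding log_mean_def by (rule continuous_on_LBINT_Icc[OF lam_growth_int])

lemma discount_continuous: "continuous_on {0..t} (\<lambda>u. exp (- \<theta> * log_mean u))"
  using log_mean_continuous by (intro continuous_intros)

text \<open>
The chain rule for \<open>mean t powr (-\<theta>)\<close>. It trades the integral against \<open>lam * a\<close>, which the backward
equation produces, for the integral against \<open>lam\<close> in \<open>V\<close>.
\<close>

lemma discount_equation:
  assumes t: "0 \<le> t"
  shows "1 - exp (- \<theta> * log_mean t)
    = \<theta> * (LBINT u:{0..t}. lam u * a u * exp (- \<theta> * log_mean u))
      - \<theta> * (LBINT u:{0..t}. lam u * exp (- \<theta> * log_mean u))"
proof -
  have "exp (- \<theta> * log_mean t) - exp (- \<theta> * log_mean 0)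
      = (LBINT u:{0..t}. lam u * (a u - 1) * (- \<theta> * exp (- \<theta> * log_mean u)))"
  proof (rule chain_rule_indefinite_integral[OF lam_growth_int, where c=0 and H="\<lambda>x. exp (- \<theta> * x)"])
    show "log_mean r = 0 + (LBINT u:{0..r}. lam u * (a u - 1))" for r by (simp add: log_mean_def)
    show "((\<lambda>x. exp (- \<theta> * x)) has_real_derivative - \<theta> * exp (- \<theta> * log_mean r)) (at (log_mean r))" for r
      by (auto intro!: derivative_eq_intros)
  qed (use t in \<open>auto intro!: continuous_intros\<close>)
  also have "log_mean 0 = 0" by (rule log_mean_0)
  also have "(LBINT u:{0..t}. lam u * (a u - 1) * (- \<theta> * exp (- \<theta> * log_mean u)))
    = (LBINT u:{0..t}. \<theta> * (lam u * exp (- \<theta> * log_mean u)) - \<theta> * (lam u * a u * exp (- \<theta> * log_mean u)))"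
    by (simp add: algebra_simps)
  also have "\<dots> = \<theta> * (LBINT u:{0..t}. lam u * exp (- \<theta> * log_mean u))
      - \<theta> * (LBINT u:{0..t}. lam u * a u * exp (- \<theta> * log_mean u))"
    using set_integral_diff(2)[OF
        set_integrable_mult_right[OF set_integrable_mult_continuous[OF lam_int[OF order_refl] discount_continuous]]
        set_integrable_mult_right[OF set_integrable_mult_continuous[OF lam_a_int[OF order_refl] discount_continuous]],
        of t \<theta> \<theta>] by simp
  finally show ?thesis by simp
qed

lemma discounted_births:
  assumes "0 \<le> t"
  shows "\<theta> / (1 + \<theta>) * (LBINT u:{0..t}. lam u * a u * exp (- \<theta> * log_mean u))
    = V t + (1 - mean t powr (-\<theta>)) / (1 + \<theta>)"
proof -
  have "V t = \<theta> * (LBINT u:{0..t}. lam u * exp (- \<theta> * log_mean u)) / (1 + \<theta>)"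
    unfolding V_def mean_powr by (simp add: mult.commute)
  then show ?thesis
    unfolding mean_powr discount_equation[OF assms] by (simp add: diff_divide_distrib)
qed

text \<open>
The Bernoulli equation is solved in logarithmic form, so that only the chain rule and no product
rule is needed: with \<open>z\<close> for \<open>marked_prob\<close>, the function \<open>L = ln z + log_mean\<close> has the density
\<open>\<psi> = lam * a * z powr \<theta> / (1 + \<theta>)\<close>, and in the density of \<open>exp (- \<theta> * L)\<close> the factor
\<open>z powr \<theta>\<close> cancels.
\<close>

lemma survival_formula_powr:
  assumes t: "0 \<le> t" and v: "v \<in> {0..<1}"
  shows "0 < 1 - F 0 t v"
    "(1 - F 0 t v) powr (-\<theta>) = V t + (1 - mean t powr (-\<theta>)) / (1 + \<theta>) + mean t powr (-\<theta>) * (1 - v) powr (-\<theta>)"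
proof -
  have v': "v \<in> {0..1}" using v by auto
  define z where "z = marked_prob t v"
  have z_cont: "continuous_on {0..t} z" unfolding z_def by (rule marked_prob_continuous[OF t v'])
  have z_pos: "0 < z s" if "s \<in> {0..t}" for s
  proof -
    have "0 < pmf (P s t 1) 1 * (1 - v)" using stay_pos[of s t] that v by simp
    also have "\<dots> \<le> z s" unfolding z_def marked_prob_def[OF t v'] by (rule one_minus_pgf_ge[OF v'])
    finally show ?thesis .
  qed
  have z_eq: "z r = z 0 + (LBINT u:{0..r}. lam u * drift (a u) (z u))" if "r \<in> {0..t}" for r
    unfolding z_def by (rule backward_equation[OF t v' that])
  have z_int: "set_integrable lborel {0..t} (\<lambda>u. lam u * drift (a u) (z u))"
    unfolding z_def by (rule lam_drift_marked_prob_int[OF t v'])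
  have zp_cont: "continuous_on {0..t} (\<lambda>u. z u powr \<theta>)"
    using z_cont z_pos \<theta> by (intro continuous_on_powr continuous_on_const) force+
  define \<psi> where "\<psi> u = lam u * a u * (z u powr \<theta> / (1 + \<theta>))" for u
  have \<psi>_int: "set_integrable lborel {0..t} \<psi>"
    unfolding \<psi>_def using zp_cont \<theta>
    by (intro set_integrable_mult_continuous lam_a_int continuous_on_divide continuous_on_const) auto
  define L where "L r = ln (z r) + log_mean r" for r
  have L: "L r = L 0 + (LBINT u:{0..r}. \<psi> u)" if r: "r \<in> {0..t}" for r
  proof -
    have sub: "{0..r} \<subseteq> {0..t}" using r by auto
    have "ln (z r) - ln (z 0) = (LBINT u:{0..r}. lam u * drift (a u) (z u) * (1 / z u))"
    proof (rule chain_rule_indefinite_integral[where H=ln and H'="\<lambda>x. 1 / x"])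
      show "set_integrable lborel {0..r} (\<lambda>u. lam u * drift (a u) (z u))"
        using r by (intro set_integrable_Icc_subset[OF z_int]) auto
      show "z q = z 0 + (LBINT u:{0..q}. lam u * drift (a u) (z u))" if "q \<in> {0..r}" for q
        using z_eq[of q] that r by auto
      show "(ln has_real_derivative 1 / z q) (at (z q))" if "q \<in> {0..r}" for q
        using z_pos[of q] that r by (intro DERIV_ln_divide) auto
      show "continuous_on (z ` {0..r}) (\<lambda>x. 1 / x)"
        using z_pos sub by (intro continuous_intros) force
    qed (use r in auto)
    also have "\<dots> = (LBINT u:{0..r}. \<psi> u - lam u * (a u - 1))"
    proof (rule set_lebesgue_integral_cong)
      show "\<forall>u. u \<in> {0..r} \<longrightarrow> lam u * drift (a u) (z u) * (1 / z u) = \<psi> u - lam u * (a u - 1)"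
      proof (intro allI impI)
        fix u assume "u \<in> {0..r}"
        then have z: "0 < z u" using z_pos[of u] r by auto
        then have "z u powr (1 + \<theta>) = z u * z u powr \<theta>" by (simp add: powr_add)
        then have eq: "drift (a u) (z u) * (1 / z u) = (1 - a u) + a u * (z u powr \<theta> / (1 + \<theta>))"
          using z unfolding drift_def by (simp add: add_divide_distrib)
        show "lam u * drift (a u) (z u) * (1 / z u) = \<psi> u - lam u * (a u - 1)"
          unfolding \<psi>_def mult.assoc eq by (simp add: algebra_simps)
      qed
    qed simp
    also have "\<dots> = (LBINT u:{0..r}. \<psi> u) - log_mean r"
      unfolding log_mean_def using r
      by (intro set_integral_diff(2) set_integrable_Icc_subset[OF \<psi>_int] lam_growth_int) auto
    finally have "ln (z r) - ln (z 0) = (LBINT u:{0..r}. \<psi> u) - log_mean r" .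
    then show ?thesis by (simp add: L_def log_mean_0)
  qed
  have expL: "exp (- \<theta> * L r) = z r powr (-\<theta>) * exp (- \<theta> * log_mean r)" if "r \<in> {0..t}" for r
    using z_pos[OF that] by (simp add: L_def powr_def exp_add[symmetric] algebra_simps)
  have "exp (- \<theta> * L t) - exp (- \<theta> * L 0) = (LBINT u:{0..t}. \<psi> u * (- \<theta> * exp (- \<theta> * L u)))"
  proof (rule chain_rule_indefinite_integral[OF \<psi>_int L, where H="\<lambda>x. exp (- \<theta> * x)"])
    show "((\<lambda>x. exp (- \<theta> * x)) has_real_derivative - \<theta> * exp (- \<theta> * L r)) (at (L r))" for r
      by (auto intro!: derivative_eq_intros)
  qed (use t in \<open>auto intro!: continuous_intros\<close>)
  also have "\<dots> = (LBINT u:{0..t}. - \<theta> / (1 + \<theta>) * (lam u * a u * exp (- \<theta> * log_mean u)))"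
  proof (rule set_lebesgue_integral_cong)
    show "\<forall>u. u \<in> {0..t} \<longrightarrow> \<psi> u * (- \<theta> * exp (- \<theta> * L u))
        = - \<theta> / (1 + \<theta>) * (lam u * a u * exp (- \<theta> * log_mean u))"
    proof (intro allI impI)
      fix u assume u: "u \<in> {0..t}"
      have "z u powr \<theta> * z u powr (-\<theta>) = 1" using z_pos[OF u] by (simp add: powr_add[symmetric])
      then have "z u powr \<theta> * exp (- \<theta> * L u) = exp (- \<theta> * log_mean u)"
        unfolding expL[OF u] by (simp add: mult.assoc[symmetric])
      then show "\<psi> u * (- \<theta> * exp (- \<theta> * L u)) = - \<theta> / (1 + \<theta>) * (lam u * a u * exp (- \<theta> * log_mean u))"
        unfolding \<psi>_def by (simp add: field_simps)
    qed
  qed simp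
  also have "\<dots> = - \<theta> / (1 + \<theta>) * (LBINT u:{0..t}. lam u * a u * exp (- \<theta> * log_mean u))"
    by (rule set_integral_mult_right)
  finally have main: "exp (- \<theta> * L 0) = exp (- \<theta> * L t)
      + \<theta> / (1 + \<theta>) * (LBINT u:{0..t}. lam u * a u * exp (- \<theta> * log_mean u))" by simp
  have L0: "exp (- \<theta> * L 0) = (1 - F 0 t v) powr (-\<theta>)"
    using expL[of 0] t by (simp add: z_def marked_prob_def[OF t v'] log_mean_0)
  have Lt: "exp (- \<theta> * L t) = (1 - v) powr (-\<theta>) * exp (- \<theta> * log_mean t)"
    using expL[of t] t F_refl[OF t v'] by (simp add: z_def marked_prob_def[OF t v'])
  show "0 < 1 - F 0 t v" using z_pos[of 0] t by (simp add: z_def marked_prob_def[OF t v'])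
  show "(1 - F 0 t v) powr (-\<theta>) = V t + (1 - mean t powr (-\<theta>)) / (1 + \<theta>) + mean t powr (-\<theta>) * (1 - v) powr (-\<theta>)"
    using main unfolding L0 Lt discounted_births[OF t] mean_powr by (simp add: mult.commute)
qed

lemma survival_formula:
  assumes t: "0 \<le> t" and v: "v \<in> {0..<1}"
  shows "1 - F 0 t v =
    (V t + (1 - mean t powr (-\<theta>)) / (1 + \<theta>) + mean t powr (-\<theta>) * (1 - v) powr (-\<theta>)) powr (- 1 / \<theta>)"
  using survival_formula_powr[OF assms] \<theta> by (simp add: powr_powr flip: survival_formula_powr(2)[OF assms])

text \<open>
Multiplying the formula for \<open>1 - F 0 t x\<close> by \<open>1 / (1 - x)\<close> inside the power leaves
\<open>mean t powr (-\<theta>)\<close> plus a multiple of \<open>(1 - x) powr \<theta>\<close>, which vanishes as \<open>x\<close> tends to 1.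
\<close>

lemma mean_population:
  assumes t: "0 \<le> t"
  shows "integrable (measure_pmf (P 0 t 1)) real" "measure_pmf.expectation (P 0 t 1) real = mean t"
proof -
  define B where "B = V t + (1 - mean t powr (-\<theta>)) / (1 + \<theta>)"
  have lim: "((\<lambda>x. (1 - F 0 t x) / (1 - x)) \<longlongrightarrow> mean t) (at_left 1)"
  proof (rule Lim_transform_eventually)
    have "((\<lambda>x. B * (1 - x) powr \<theta> + mean t powr (-\<theta>)) \<longlongrightarrow> B * 0 + mean t powr (-\<theta>)) (at_left 1)"
    proof (intro tendsto_intros)
      have "((\<lambda>x::real. (1 - x) powr \<theta>) \<longlongrightarrow> 0 powr \<theta>) (at_left 1)"
      proof (rule tendsto_powr')
        show "((\<lambda>x::real. 1 - x) \<longlongrightarrow> 0) (at_left 1)"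
          by (auto intro!: tendsto_eq_intros)
        show "(0::real) \<noteq> 0 \<or> 0 < \<theta> \<and> (\<forall>\<^sub>F x in at_left (1::real). 0 \<le> 1 - x)"
          using \<theta> by (auto simp: eventually_at_filter)
      qed simp
      then show "((\<lambda>x::real. (1 - x) powr \<theta>) \<longlongrightarrow> 0) (at_left 1)" by simp
    qed
    then have "((\<lambda>x. (B * (1 - x) powr \<theta> + mean t powr (-\<theta>)) powr (- 1 / \<theta>)) \<longlongrightarrow>
        (B * 0 + mean t powr (-\<theta>)) powr (- 1 / \<theta>)) (at_left 1)"
      using mean_pos[of t] by (intro tendsto_powr tendsto_const) auto
    also have "(B * 0 + mean t powr (-\<theta>)) powr (- 1 / \<theta>) = mean t"
      using mean_pos[of t] \<theta> by (simp add: powr_powr)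
    finally show "((\<lambda>x. (B * (1 - x) powr \<theta> + mean t powr (-\<theta>)) powr (- 1 / \<theta>)) \<longlongrightarrow> mean t) (at_left 1)" .
    have "\<forall>\<^sub>F x in at_left (1::real). x \<in> {0<..<1}"
      by (intro eventually_at_leftI[of 0]) auto
    then show "\<forall>\<^sub>F x in at_left 1. (B * (1 - x) powr \<theta> + mean t powr (-\<theta>)) powr (- 1 / \<theta>) = (1 - F 0 t x) / (1 - x)"
    proof eventually_elim
      case (elim x)
      then have x: "x \<in> {0..<1}" "0 < 1 - x" by auto
      define w where "w = 1 - F 0 t x"
      have w: "0 < w" "w powr (-\<theta>) = B + mean t powr (-\<theta>) * (1 - x) powr (-\<theta>)"
        using survival_formula_powr[OF t x(1)] by (simp_all add: w_def B_def)
      have "(w / (1 - x)) powr (-\<theta>) = w powr (-\<theta>) * (1 - x) powr \<theta>"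
        using w(1) x(2) by (simp add: powr_divide powr_minus field_simps)
      also have "\<dots> = B * (1 - x) powr \<theta> + mean t powr (-\<theta>) * ((1 - x) powr (-\<theta>) * (1 - x) powr \<theta>)"
        unfolding w(2) by (simp add: algebra_simps)
      also have "(1 - x) powr (-\<theta>) * (1 - x) powr \<theta> = 1"
        using x(2) by (simp add: powr_add[symmetric])
      finally have e: "B * (1 - x) powr \<theta> + mean t powr (-\<theta>) = (w / (1 - x)) powr (-\<theta>)" by simp
      show ?case unfolding e w_def[symmetric] using w(1) x(2) \<theta> by (simp add: powr_powr)
    qed
  qed
  show "integrable (measure_pmf (P 0 t 1)) real" "measure_pmf.expectation (P 0 t 1) real = mean t"
    using mean_of_pgf[OF lim] by auto
qed

text \<open>
State 0 is absorbing; in terms of generating functions, \<open>F s t 0\<close> is nonnegative and \<open>F 0 s\<close> is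
nondecreasing.
\<close>

lemma extinction_mono:
  assumes "0 \<le> s" "s \<le> t"
  shows "pmf (P 0 s 1) 0 \<le> pmf (P 0 t 1) 0"
proof -
  have "F 0 t 0 = F 0 s (F s t 0)" using assms by (intro F_compose) auto
  moreover have "F 0 s 0 \<le> F 0 s (F s t 0)" using F_in[of 0 s t] by (intro pgf_mono) auto
  ultimately show ?thesis by (simp add: pgf_0)
qed


section \<open>Long-time behaviour of the mean and of the survival probability\<close>

lemma mean_powr_continuous: "continuous_on {0..t} (\<lambda>u. mean u powr (-\<theta>))"
  unfolding mean_powr by (rule discount_continuous)

lemma V_int:
  assumes "0 \<le> s"
  shows "set_integrable lborel {s..t} (\<lambda>u. mean u powr (-\<theta>) * lam u)"
proof -
  have "set_integrable lborel {0..t} (\<lambda>u. lam u * mean u powr (-\<theta>))"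
    by (rule set_integrable_mult_continuous[OF lam_int[OF order_refl] mean_powr_continuous])
  then have "set_integrable lborel {s..t} (\<lambda>u. lam u * mean u powr (-\<theta>))"
    using assms by (rule set_integrable_Icc_subset) simp
  then show ?thesis by (simp add: mult.commute)
qed

lemma V_increment:
  assumes "0 \<le> s" "s \<le> t"
  shows "V t - V s = \<theta> / (1 + \<theta>) * (LBINT u:{s..t}. mean u powr (-\<theta>) * lam u)"
  unfolding V_def right_diff_distrib[symmetric]
    LBINT_Icc_diff[OF V_int[OF order_refl] assms order_refl] ..

lemma V_increment_ge:
  assumes st: "0 \<le> s" "s \<le> t" and c: "\<And>u. s \<le> u \<Longrightarrow> u \<le> t \<Longrightarrow> c \<le> mean u powr (-\<theta>)"
  shows "\<theta> / (1 + \<theta>) * (c * \<Lambda> s t) \<le> V t - V s"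
proof -
  have "c * \<Lambda> s t = (LBINT u:{s..t}. c * lam u)" by simp
  also have "\<dots> \<le> (LBINT u:{s..t}. mean u powr (-\<theta>) * lam u)"
  proof (rule set_integral_mono)
    show "set_integrable lborel {s..t} (\<lambda>u. c * lam u)"
      by (rule set_integrable_mult_right[OF lam_int[OF st(1)]])
    show "set_integrable lborel {s..t} (\<lambda>u. mean u powr (-\<theta>) * lam u)" by (rule V_int[OF st(1)])
    fix u assume "u \<in> {s..t}"
    then show "c * lam u \<le> mean u powr (-\<theta>) * lam u"
      using c[of u] lam_nonneg[of u] st by (intro mult_right_mono) auto
  qed
  finally show ?thesis
    unfolding V_increment[OF st] using \<theta> by (intro mult_left_mono) auto
qed

lemma V_increment_le:
  assumes st: "0 \<le> s" "s \<le> t" and c: "\<And>u. s \<le> u \<Longrightarrow> u \<le> t \<Longrightarrow> mean u powr (-\<theta>) \<le> c"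
  shows "V t - V s \<le> \<theta> / (1 + \<theta>) * (c * \<Lambda> s t)"
proof -
  have "(LBINT u:{s..t}. mean u powr (-\<theta>) * lam u) \<le> (LBINT u:{s..t}. c * lam u)"
  proof (rule set_integral_mono)
    show "set_integrable lborel {s..t} (\<lambda>u. c * lam u)"
      by (rule set_integrable_mult_right[OF lam_int[OF st(1)]])
    show "set_integrable lborel {s..t} (\<lambda>u. mean u powr (-\<theta>) * lam u)" by (rule V_int[OF st(1)])
    fix u assume "u \<in> {s..t}"
    then show "mean u powr (-\<theta>) * lam u \<le> c * lam u"
      using c[of u] lam_nonneg[of u] st by (intro mult_right_mono) auto
  qed
  also have "\<dots> = c * \<Lambda> s t" by simp
  finally show ?thesis
    unfolding V_increment[OF st] using \<theta> by (intro mult_left_mono) auto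
qed

lemma V_mono: "0 \<le> s \<Longrightarrow> s \<le> t \<Longrightarrow> V s \<le> V t"
  using V_increment_ge[of s t 0] by simp

lemma V_0: "V 0 = 0"
  by (simp add: V_def)

lemma \<Lambda>_0_mono: "0 \<le> s \<Longrightarrow> s \<le> t \<Longrightarrow> \<Lambda> 0 s \<le> \<Lambda> 0 t"
  by (rule \<Lambda>_mono) auto

lemma total_rate_finite_iff: "total_rate lam < \<infinity> \<longleftrightarrow> (\<exists>B. \<forall>t\<ge>0. \<Lambda> 0 t \<le> B)"
  unfolding total_rate_def cumulative_rate_def
  by (rule ereal_Lim_at_top_finite_iff[OF \<Lambda>_0_mono])

text \<open>
The exponent \<open>log_mean\<close> is a difference of two nondecreasing functions, the integrals of \<open>lam * a\<close>
and of \<open>lam\<close>; both are bounded if the second is.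
\<close>

lemma finite_rate_limits:
  assumes B: "\<And>t. 0 \<le> t \<Longrightarrow> \<Lambda> 0 t \<le> B"
  obtains \<mu> v where "0 < \<mu>" "(mean \<longlongrightarrow> \<mu>) at_top" "(V \<longlongrightarrow> v) at_top" "0 \<le> v"
    "\<forall>t\<ge>0. mean t \<le> exp (max_offspring_mean * B)"
proof -
  define G where "G t = (LBINT u:{0..t}. lam u * a u)" for t
  have G_diff: "G t - G s = (LBINT u:{s..t}. lam u * a u)" if "0 \<le> s" "s \<le> t" for s t
    unfolding G_def using that by (intro LBINT_Icc_diff[OF lam_a_int[OF order_refl]]) auto
  have G_mono: "G s \<le> G t" if "0 \<le> s" "s \<le> t" for s t
  proof -
    have "0 \<le> (LBINT u:{s..t}. lam u * a u)"
      unfolding set_lebesgue_integral_def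
      by (intro integral_nonneg_AE always_eventually)
         (use that in \<open>auto simp: indicator_def lam_nonneg a_bounds\<close>)
    then show ?thesis using G_diff[OF that] by simp
  qed
  have max_offspring_mean0: "0 \<le> max_offspring_mean" using max_offspring_mean_ge_2 by simp
  have G_le: "G t \<le> max_offspring_mean * B" if "0 \<le> t" for t
  proof -
    have "\<bar>LBINT u:{0..t}. lam u * a u\<bar> \<le> max_offspring_mean * \<Lambda> 0 t"
      by (intro LBINT_lam_le lam_a_int a_le_max_offspring_mean) auto
    also have "\<dots> \<le> max_offspring_mean * B" by (intro mult_left_mono B that max_offspring_mean0)
    finally show ?thesis by (simp add: G_def)
  qed
  have log_mean: "log_mean t = G t - \<Lambda> 0 t" for t
    unfolding log_mean_def G_def right_diff_distrib
    using set_integral_diff(2)[OF lam_a_int[OF order_refl] lam_int[OF order_refl]] by simp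
  obtain g where g: "(G \<longlongrightarrow> g) at_top"
    by (rule tendsto_at_top_mono_bounded[OF G_mono G_le])
  obtain l where l: "((\<lambda>t. \<Lambda> 0 t) \<longlongrightarrow> l) at_top"
    by (rule tendsto_at_top_mono_bounded[OF \<Lambda>_0_mono B])
  have mean_lim: "(mean \<longlongrightarrow> exp (g - l)) at_top"
    unfolding mean_def[abs_def] log_mean by (intro tendsto_intros g l)
  have G_nonneg: "0 \<le> G t" if "0 \<le> t" for t
    using G_mono[of 0 t] that by (simp add: G_def)
  have inv_le: "mean t powr (-\<theta>) \<le> exp (\<theta> * B)" if "0 \<le> t" for t
  proof -
    have "- log_mean t \<le> B" using log_mean[of t] G_nonneg[OF that] B[OF that] by simp
    then have "\<theta> * (- log_mean t) \<le> \<theta> * B" using \<theta> by (intro mult_left_mono) auto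
    then show ?thesis unfolding mean_powr by simp
  qed
  have "V t \<le> \<theta> / (1 + \<theta>) * (exp (\<theta> * B) * B)" if "0 \<le> t" for t
  proof -
    have "V t \<le> \<theta> / (1 + \<theta>) * (exp (\<theta> * B) * \<Lambda> 0 t)"
      using V_increment_le[of 0 t "exp (\<theta> * B)"] that inv_le by (simp add: V_0)
    also have "\<dots> \<le> \<theta> / (1 + \<theta>) * (exp (\<theta> * B) * B)"
      using \<theta> B[OF that] by (intro mult_left_mono) auto
    finally show ?thesis .
  qed
  with V_mono obtain v where v: "(V \<longlongrightarrow> v) at_top" "\<forall>t\<ge>0. V t \<le> v"
    by (rule tendsto_at_top_mono_bounded)
  have "mean t \<le> exp (max_offspring_mean * B)" if "0 \<le> t" for t
    using log_mean[of t] G_le[OF that] \<Lambda>_nonneg[of 0 t] by (simp add: mean_def)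
  then show ?thesis using that[OF _ mean_lim v(1)] v(2)[rule_format, of 0] V_0 by simp
qed

lemma survival_limit:
  assumes \<mu>: "(mean \<longlongrightarrow> \<mu>) at_top" "0 < \<mu>" and v: "(V \<longlongrightarrow> v) at_top" "0 \<le> v" and s: "s \<in> {0..<1}"
  shows "0 < v + (1 - \<mu> powr (-\<theta>)) / (1 + \<theta>) + \<mu> powr (-\<theta>) * (1 - s) powr (-\<theta>)"
    and "((\<lambda>t. F 0 t s) \<longlongrightarrow>
      1 - (v + (1 - \<mu> powr (-\<theta>)) / (1 + \<theta>) + \<mu> powr (-\<theta>) * (1 - s) powr (-\<theta>)) powr (- 1 / \<theta>)) at_top"
proof -
  have "1 \<le> (1 - s) powr (-\<theta>)"
    using powr_mono2'[of "-\<theta>" "1 - s" 1] s \<theta> by simp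
  then have "\<mu> powr (-\<theta>) * 1 \<le> \<mu> powr (-\<theta>) * (1 - s) powr (-\<theta>)"
    by (intro mult_left_mono) auto
  moreover have "- (\<mu> powr (-\<theta>)) < (1 - \<mu> powr (-\<theta>)) / (1 + \<theta>)"
  proof -
    have "0 < \<theta> * \<mu> powr (-\<theta>)" using \<theta> \<mu>(2) by simp
    then show ?thesis using \<theta> by (simp add: field_simps)
  qed
  ultimately show pos: "0 < v + (1 - \<mu> powr (-\<theta>)) / (1 + \<theta>) + \<mu> powr (-\<theta>) * (1 - s) powr (-\<theta>)"
    using v(2) by simp
  have m: "((\<lambda>t. mean t powr (-\<theta>)) \<longlongrightarrow> \<mu> powr (-\<theta>)) at_top"
    using \<mu> by (intro tendsto_powr tendsto_const) auto
  have "((\<lambda>t. 1 - (V t + (1 - mean t powr (-\<theta>)) / (1 + \<theta>) + mean t powr (-\<theta>) * (1 - s) powr (-\<theta>)) powr (- 1 / \<theta>))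
    \<longlongrightarrow> 1 - (v + (1 - \<mu> powr (-\<theta>)) / (1 + \<theta>) + \<mu> powr (-\<theta>) * (1 - s) powr (-\<theta>)) powr (- 1 / \<theta>)) at_top"
  proof (rule tendsto_diff[OF tendsto_const tendsto_powr[OF _ tendsto_const]])
    show "((\<lambda>t. V t + (1 - mean t powr (-\<theta>)) / (1 + \<theta>) + mean t powr (-\<theta>) * (1 - s) powr (-\<theta>))
      \<longlongrightarrow> v + (1 - \<mu> powr (-\<theta>)) / (1 + \<theta>) + \<mu> powr (-\<theta>) * (1 - s) powr (-\<theta>)) at_top"
      using \<theta> by (intro tendsto_add tendsto_diff tendsto_divide tendsto_mult tendsto_const v(1) m) auto
  qed (use pos in simp)
  then show "((\<lambda>t. F 0 t s) \<longlongrightarrow>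
      1 - (v + (1 - \<mu> powr (-\<theta>)) / (1 + \<theta>) + \<mu> powr (-\<theta>) * (1 - s) powr (-\<theta>)) powr (- 1 / \<theta>)) at_top"
  proof (rule Lim_transform_eventually)
    show "\<forall>\<^sub>F t in at_top. 1 - (V t + (1 - mean t powr (-\<theta>)) / (1 + \<theta>) + mean t powr (-\<theta>) * (1 - s) powr (-\<theta>)) powr (- 1 / \<theta>)
      = F 0 t s"
      using eventually_ge_at_top[of 0]
    proof eventually_elim
      case (elim t)
      show ?case unfolding survival_formula[OF elim s, symmetric] by simp
    qed
  qed
qed

text \<open>
With \<open>m = mean powr (-\<theta>)\<close>, the survival formula says that \<open>A + m\<close> is a negative power of the
survival probability, so it is bounded. Both \<open>V\<close> and \<open>A\<close> are nondecreasing, hence convergent, and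
\<open>m\<close> is a linear combination of them.
\<close>

lemma bounded_rate_if_survival:
  assumes q: "\<And>t. 0 \<le> t \<Longrightarrow> pmf (P 0 t 1) 0 \<le> q" "q < 1"
    and not_top: "\<not> filterlim mean at_top at_top"
  shows "\<exists>B. \<forall>t\<ge>0. \<Lambda> 0 t \<le> B"
proof -
  define K where "K = (1 - q) powr (-\<theta>)"
  define m where "m t = mean t powr (-\<theta>)" for t
  define A where "A t = V t + (1 - m t) / (1 + \<theta>)" for t
  have m_pos: "0 < m t" for t using mean_pos[of t] by (simp add: m_def)
  have AK: "A t + m t \<le> K" if "0 \<le> t" for t
  proof -
    have "A t + m t = (1 - F 0 t 0) powr (-\<theta>)"
      using survival_formula_powr(2)[OF that, of 0] by (simp add: A_def m_def)
    also have "\<dots> \<le> K"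
      unfolding K_def using q that \<theta> by (intro powr_mono2') (auto simp: pgf_0)
    finally show ?thesis .
  qed
  have V_nonneg: "0 \<le> V t" if "0 \<le> t" for t using V_mono[of 0 t] V_0 that by simp
  have VK: "V t \<le> K" if "0 \<le> t" for t
  proof -
    have "- m t \<le> (1 - m t) / (1 + \<theta>)"
    proof -
      have "m t / (1 + \<theta>) \<le> m t" using \<theta> m_pos[of t] by (simp add: divide_le_eq)
      moreover have "0 \<le> 1 / (1 + \<theta>)" using \<theta> by simp
      ultimately show ?thesis unfolding diff_divide_distrib by linarith
    qed
    then show ?thesis using AK[OF that] by (simp add: A_def)
  qed
  obtain v where v: "(V \<longlongrightarrow> v) at_top"
    by (rule tendsto_at_top_mono_bounded[OF V_mono VK])
  have A_mono: "A s \<le> A t" if "0 \<le> s" "s \<le> t" for s t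
  proof -
    have A: "A r = \<theta> / (1 + \<theta>) * (LBINT u:{0..r}. lam u * a u * exp (- \<theta> * log_mean u))" if "0 \<le> r" for r
      using discounted_births[OF that] by (simp add: A_def m_def)
    have int: "set_integrable lborel {0..t} (\<lambda>u. lam u * a u * exp (- \<theta> * log_mean u))"
      by (intro set_integrable_mult_continuous lam_a_int discount_continuous order_refl)
    have "0 \<le> (LBINT u:{s..t}. lam u * a u * exp (- \<theta> * log_mean u))"
      unfolding set_lebesgue_integral_def
      by (intro integral_nonneg_AE always_eventually)
         (use that in \<open>auto simp: indicator_def lam_nonneg a_bounds\<close>)
    then have "0 \<le> \<theta> / (1 + \<theta>) * ((LBINT u:{0..t}. lam u * a u * exp (- \<theta> * log_mean u))
        - (LBINT u:{0..s}. lam u * a u * exp (- \<theta> * log_mean u)))"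
      unfolding LBINT_Icc_diff[OF int that order_refl] using \<theta> by simp
    then show ?thesis using A that by (simp add: right_diff_distrib)
  qed
  have AK': "A t \<le> K" if "0 \<le> t" for t using AK[OF that] m_pos[of t] by simp
  obtain \<alpha> where \<alpha>: "(A \<longlongrightarrow> \<alpha>) at_top"
    by (rule tendsto_at_top_mono_bounded[OF A_mono AK'])
  define minf where "minf = 1 - (1 + \<theta>) * (\<alpha> - v)"
  have m: "m t = 1 - (1 + \<theta>) * (A t - V t)" for t
    using \<theta> by (simp add: A_def)
  have m_lim: "(m \<longlongrightarrow> minf) at_top"
    unfolding m[abs_def] minf_def by (intro tendsto_intros \<alpha> v)
  have "0 \<le> minf"
    by (rule tendsto_lowerbound[OF m_lim]) (auto intro!: always_eventually less_imp_le m_pos)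
  moreover have "minf \<noteq> 0"
  proof
    assume "minf = 0"
    then have m0: "(m \<longlongrightarrow> 0) at_top" using m_lim by simp
    have "filterlim mean at_top at_top"
      unfolding filterlim_at_top_gt[of mean at_top 0]
    proof (intro allI impI)
      fix x :: real assume x: "0 < x"
      then have "\<forall>\<^sub>F t in at_top. m t < x powr (-\<theta>)"
        by (intro order_tendstoD(2)[OF m0]) auto
      then show "\<forall>\<^sub>F t in at_top. x \<le> mean t"
      proof eventually_elim
        case (elim t)
        show ?case
        proof (rule ccontr)
          assume "\<not> x \<le> mean t"
          then have "x powr (-\<theta>) \<le> m t"
            unfolding m_def using \<theta> mean_pos[of t] by (intro powr_mono2') auto
          with elim show False by simp
        qed
      qed
    qed
    with not_top show False by simp
  qed
  ultimately have minf: "0 < minf" by simp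
  then have "\<forall>\<^sub>F t in at_top. minf / 2 < m t" by (intro order_tendstoD(1)[OF m_lim]) simp
  then obtain T0 where T0: "\<And>t. T0 \<le> t \<Longrightarrow> minf / 2 < m t" by (auto simp: eventually_at_top_linorder)
  define T where "T = max 0 T0"
  have T: "0 \<le> T" "T0 \<le> T" by (auto simp: T_def)
  \<comment> \<open>After time \<open>T\<close> the density of \<open>V\<close> against \<open>lam\<close> is at least \<open>c\<close>.\<close>
  define c where "c = \<theta> / (1 + \<theta>) * (minf / 2)"
  have c: "0 < c" using \<theta> minf by (simp add: c_def)
  show ?thesis
  proof (intro exI[of _ "\<Lambda> 0 T + K / c"] allI impI)
    fix t :: real assume t: "0 \<le> t"
    have K0: "0 \<le> K" by (simp add: K_def)
    show "\<Lambda> 0 t \<le> \<Lambda> 0 T + K / c"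
    proof (cases "t \<le> T")
      case True
      then show ?thesis using \<Lambda>_0_mono[OF t True] K0 c by (simp add: add_increasing2)
    next
      case False
      then have "c * \<Lambda> T t \<le> V t - V T"
        using V_increment_ge[of T t "minf / 2"] T T0 unfolding m_def c_def
        by (auto simp: less_imp_le mult.assoc)
      also have "\<dots> \<le> K" using VK[OF t] V_nonneg[OF T(1)] by simp
      finally have "\<Lambda> T t \<le> K / c" using c by (simp add: field_simps)
      then show ?thesis using \<Lambda>_add[of 0 T t] T False by simp
    qed
  qed
qed

end


section \<open>Sample paths\<close>

locale theta_process = theta_branching \<theta> lam a p P + prob_space M
  for \<theta> lam a p P and M :: "'w measure" +
  fixes Z :: "real \<Rightarrow> 'w \<Rightarrow> nat"
  assumes Z_meas0: "\<And>t. 0 \<le> t \<Longrightarrow> Z t \<in> measurable M (count_space UNIV)"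
    and Z_right_cont: "\<And>\<omega> t. \<omega> \<in> space M \<Longrightarrow> 0 \<le> t \<Longrightarrow> continuous (at_right t) (\<lambda>u. Z u \<omega>)"
    and fdd: "\<And>\<tau> x m. \<tau> 0 = 0 \<Longrightarrow> mono \<tau> \<Longrightarrow>
           measure M {\<omega> \<in> space M. \<forall>i\<le>m. Z (\<tau> i) \<omega> = x i} =
             of_bool (x 0 = 1) * (\<Prod>i<m. pmf (P (\<tau> i) (\<tau> (Suc i)) (x i)) (x (Suc i)))"
begin

lemma Z_meas [measurable]: "Z (max 0 t) \<in> measurable M (count_space UNIV)"
  by (rule Z_meas0) simp

lemma Z_pred [measurable]: "0 \<le> t \<Longrightarrow> Measurable.pred M (\<lambda>\<omega>. Z t \<omega> = k)"
  using Z_meas[of t] by (simp add: max_def) measurable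

lemma Z_sets: "0 \<le> t \<Longrightarrow> {\<omega> \<in> space M. Z t \<omega> = k} \<in> sets M"
  using Z_pred[of t k] by (simp add: pred_def)

lemma Z_pair_sets:
  assumes "0 \<le> s" "0 \<le> t"
  shows "{\<omega> \<in> space M. Z s \<omega> = j \<and> Z t \<omega> = k} \<in> sets M"
proof -
  have "{\<omega> \<in> space M. Z s \<omega> = j \<and> Z t \<omega> = k} = {\<omega> \<in> space M. Z s \<omega> = j} \<inter> {\<omega> \<in> space M. Z t \<omega> = k}"
    by blast
  then show ?thesis using Z_sets assms by simp
qed

lemma AE_Z_0: "AE \<omega> in M. Z 0 \<omega> = 1"
  using prob_Collect_eq_1[OF Z_sets, of 0 1] fdd[of "\<lambda>_. 0" 0 "\<lambda>_. 1"] by (simp add: mono_def)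

lemma prob_Z_0_and:
  assumes A: "A \<in> sets M"
  shows "prob ({\<omega> \<in> space M. Z 0 \<omega> = 1} \<inter> A) = prob A"
proof (rule finite_measure_eq_AE)
  show "AE \<omega> in M. \<omega> \<in> {\<omega> \<in> space M. Z 0 \<omega> = 1} \<inter> A \<longleftrightarrow> \<omega> \<in> A"
    using AE_Z_0 AE_space by eventually_elim simp
qed (use A Z_sets[of 0 1] in auto)

lemma prob_Z:
  assumes "0 \<le> t"
  shows "prob {\<omega> \<in> space M. Z t \<omega> = k} = pmf (P 0 t 1) k"
proof -
  define \<tau> where "\<tau> i = (if i = 0 then 0 else t)" for i :: nat
  define x where "x i = (if i = 0 then 1 else k)" for i :: nat
  have "{\<omega> \<in> space M. Z 0 \<omega> = 1} \<inter> {\<omega> \<in> space M. Z t \<omega> = k}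
      = {\<omega> \<in> space M. \<forall>i\<le>1. Z (\<tau> i) \<omega> = x i}"
    unfolding \<tau>_def x_def One_nat_def le_Suc_eq le_0_eq by auto
  moreover have "prob {\<omega> \<in> space M. \<forall>i\<le>1. Z (\<tau> i) \<omega> = x i} = pmf (P 0 t 1) k"
    using fdd[of \<tau> 1 x] assms by (simp add: \<tau>_def x_def mono_def)
  ultimately show ?thesis using prob_Z_0_and[OF Z_sets[OF assms, of k]] by simp
qed

lemma prob_Z_Z:
  assumes "0 \<le> s" "s \<le> t"
  shows "prob {\<omega> \<in> space M. Z s \<omega> = j \<and> Z t \<omega> = k} = pmf (P 0 s 1) j * pmf (P s t j) k"
proof -
  \<comment> \<open>The initial time 0 must be included; there the value is 1 almost surely.\<close>
  define \<tau> where "\<tau> i = (if i = 0 then 0 else if i = 1 then s else t)" for i :: nat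
  define x where "x i = (if i = 0 then 1 else if i = 1 then j else k)" for i :: nat
  have i2: "i \<le> 2 \<longleftrightarrow> i = 0 \<or> i = 1 \<or> i = 2" for i :: nat by linarith
  have "{\<omega> \<in> space M. Z 0 \<omega> = 1} \<inter> {\<omega> \<in> space M. Z s \<omega> = j \<and> Z t \<omega> = k}
      = {\<omega> \<in> space M. \<forall>i\<le>2. Z (\<tau> i) \<omega> = x i}"
    unfolding \<tau>_def x_def i2 by auto
  moreover have "prob {\<omega> \<in> space M. \<forall>i\<le>2. Z (\<tau> i) \<omega> = x i} = pmf (P 0 s 1) j * pmf (P s t j) k"
  proof (subst fdd)
    show "mono \<tau>" using assms by (auto simp: mono_def \<tau>_def)
  qed (simp_all add: \<tau>_def x_def eval_nat_numeral)
  ultimately show ?thesis using prob_Z_0_and[OF Z_pair_sets[of s t j k]] assms by simp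
qed

lemma distr_Z:
  assumes "0 \<le> t"
  shows "distr M (count_space UNIV) (Z t) = measure_pmf (P 0 t 1)"
proof (rule measure_eqI_countable[of _ UNIV])
  fix k
  have "emeasure (distr M (count_space UNIV) (Z t)) {k} = emeasure M {\<omega> \<in> space M. Z t \<omega> = k}"
    using Z_meas0[OF assms] by (subst emeasure_distr) (auto intro!: arg_cong[of _ _ "emeasure M"])
  then show "emeasure (distr M (count_space UNIV) (Z t)) {k} = emeasure (measure_pmf (P 0 t 1)) {k}"
    using prob_Z[OF assms, of k] by (simp add: emeasure_eq_measure emeasure_pmf_single)
qed auto

lemma expectation_Z:
  assumes "0 \<le> t"
  shows "expectation (\<lambda>\<omega>. f (Z t \<omega>)) = measure_pmf.expectation (P 0 t 1) (f :: nat \<Rightarrow> real)"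
  unfolding distr_Z[OF assms, symmetric] by (subst integral_distr[OF Z_meas0[OF assms]]) auto

lemma mean_size_eq: "0 \<le> t \<Longrightarrow> mean_size M Z t = mean t"
  unfolding mean_size_def using expectation_Z[of t real] mean_population(2)[of t] by simp

lemma expectation_power_Z: "0 \<le> t \<Longrightarrow> expectation (\<lambda>\<omega>. v ^ Z t \<omega>) = F 0 t v"
  using expectation_Z[of t "\<lambda>k. v ^ k"] by (simp add: pgf_def)

text \<open>
Given the size \<open>n\<close> at time \<open>s\<close>, a change has probability at most \<open>n\<close> times the probability that a
single individual changes; averaging over \<open>n\<close> produces the mean.
\<close>

lemma prob_change_le:
  assumes st: "0 \<le> s" "s \<le> t"
  shows "prob {\<omega> \<in> space M. Z s \<omega> \<noteq> Z t \<omega>} \<le> mean s * (2 * \<Lambda> s t)"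
proof -
  define A where "A n = {\<omega> \<in> space M. Z s \<omega> = n} - {\<omega> \<in> space M. Z s \<omega> = n \<and> Z t \<omega> = n}" for n
  have st': "0 \<le> t" using st by simp
  have sets2: "{\<omega> \<in> space M. Z s \<omega> = n \<and> Z t \<omega> = n} \<in> sets M" for n
    by (intro Z_pair_sets st st')
  have sets: "A n \<in> sets M" for n
    unfolding A_def by (intro sets.Diff sets2 Z_sets st)
  have PA: "prob (A n) \<le> pmf (P 0 s 1) n * real n * (2 * \<Lambda> s t)" for n
  proof -
    have "prob (A n) = pmf (P 0 s 1) n - pmf (P 0 s 1) n * pmf (P s t n) n"
      unfolding A_def
      by (subst finite_measure_Diff[OF Z_sets[OF st(1)] sets2]) (auto simp: prob_Z[OF st(1)] prob_Z_Z[OF st])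
    also have "\<dots> = pmf (P 0 s 1) n * (1 - pmf (P s t n) n)" by (simp add: algebra_simps)
    also have "\<dots> \<le> pmf (P 0 s 1) n * (real n * (1 - pmf (P s t 1) 1))"
      by (intro mult_left_mono leave_le st) auto
    also have "\<dots> \<le> pmf (P 0 s 1) n * (real n * (2 * \<Lambda> s t))"
      by (intro mult_left_mono leave_le_rate st) auto
    finally show ?thesis by (simp add: mult.assoc)
  qed
  have "(\<lambda>n. prob (A n)) sums prob (\<Union>n. A n)"
    by (rule finite_measure_UNION) (use sets in \<open>auto simp: disjoint_family_on_def A_def\<close>)
  moreover have "(\<lambda>n. pmf (P 0 s 1) n * real n * (2 * \<Lambda> s t)) sums (mean s * (2 * \<Lambda> s t))"
    using sums_mult2[OF pmf_expectation_sums[OF mean_population(1)[OF st(1)]]]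
    unfolding mean_population(2)[OF st(1)] .
  ultimately have "prob (\<Union>n. A n) \<le> mean s * (2 * \<Lambda> s t)"
    by (rule sums_le[OF PA])
  also have "(\<Union>n. A n) = {\<omega> \<in> space M. Z s \<omega> \<noteq> Z t \<omega>}" by (auto simp: A_def)
  finally show ?thesis .
qed

lemma sets_change: "0 \<le> s \<Longrightarrow> 0 \<le> t \<Longrightarrow> {\<omega> \<in> space M. Z s \<omega> \<noteq> Z t \<omega>} \<in> sets M"
proof -
  assume st: "0 \<le> s" "0 \<le> t"
  have "{\<omega> \<in> space M. Z s \<omega> \<noteq> Z t \<omega>} = (\<Union>n. {\<omega> \<in> space M. Z s \<omega> = n} - {\<omega> \<in> space M. Z t \<omega> = n})"
    by auto
  then show ?thesis using Z_sets st by auto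
qed

text \<open>
Union bound over the steps of the grid; the bounds telescope because the integrated rate is additive.
\<close>

lemma prob_grid_change_le:
  fixes \<tau> :: "nat \<Rightarrow> real"
  assumes \<tau>: "mono \<tau>" "0 \<le> \<tau> 0" and B: "\<And>t. 0 \<le> t \<Longrightarrow> mean t \<le> B"
  shows "prob {\<omega> \<in> space M. \<exists>k\<le>n. Z (\<tau> k) \<omega> \<noteq> Z (\<tau> 0) \<omega>} \<le> B * (2 * \<Lambda> (\<tau> 0) (\<tau> n))"
proof (induction n)
  case 0
  have "0 \<le> B" using B[of 0] mean_pos[of 0] by simp
  then show ?case using \<Lambda>_nonneg[OF \<tau>(2), of "\<tau> 0"] by simp
next
  case (Suc n)
  have pos: "0 \<le> \<tau> k" for k using monoD[OF \<tau>(1), of 0 k] \<tau>(2) by simp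
  let ?E = "\<lambda>n. {\<omega> \<in> space M. \<exists>k\<le>n. Z (\<tau> k) \<omega> \<noteq> Z (\<tau> 0) \<omega>}"
  have setsE: "?E n \<in> sets M" for n
  proof -
    have "?E n = (\<Union>k\<in>{..n}. {\<omega> \<in> space M. Z (\<tau> k) \<omega> \<noteq> Z (\<tau> 0) \<omega>})" by auto
    then show ?thesis using sets_change pos by auto
  qed
  have "prob (?E (Suc n)) \<le> prob (?E n \<union> {\<omega> \<in> space M. Z (\<tau> n) \<omega> \<noteq> Z (\<tau> (Suc n)) \<omega>})"
  proof (rule finite_measure_mono)
    show "?E (Suc n) \<subseteq> ?E n \<union> {\<omega> \<in> space M. Z (\<tau> n) \<omega> \<noteq> Z (\<tau> (Suc n)) \<omega>}"
    proof
      fix \<omega> assume "\<omega> \<in> ?E (Suc n)"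
      then obtain k where k: "\<omega> \<in> space M" "k \<le> Suc n" "Z (\<tau> k) \<omega> \<noteq> Z (\<tau> 0) \<omega>" by blast
      show "\<omega> \<in> ?E n \<union> {\<omega> \<in> space M. Z (\<tau> n) \<omega> \<noteq> Z (\<tau> (Suc n)) \<omega>}"
      proof (cases "k \<le> n")
        case True
        with k show ?thesis by blast
      next
        case False
        with k(2) have "k = Suc n" by simp
        with k show ?thesis by (cases "Z (\<tau> n) \<omega> = Z (\<tau> (Suc n)) \<omega>") auto
      qed
    qed
  qed (use setsE sets_change pos in auto)
  also have "\<dots> \<le> prob (?E n) + prob {\<omega> \<in> space M. Z (\<tau> n) \<omega> \<noteq> Z (\<tau> (Suc n)) \<omega>}"
    by (intro measure_Un_le setsE sets_change pos)
  also have "\<dots> \<le> B * (2 * \<Lambda> (\<tau> 0) (\<tau> n)) + mean (\<tau> n) * (2 * \<Lambda> (\<tau> n) (\<tau> (Suc n)))"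
    by (intro add_mono Suc.IH prob_change_le pos monoD[OF \<tau>(1)]) simp
  also have "\<dots> \<le> B * (2 * \<Lambda> (\<tau> 0) (\<tau> n)) + B * (2 * \<Lambda> (\<tau> n) (\<tau> (Suc n)))"
    using \<Lambda>_nonneg[OF pos[of n], of "\<tau> (Suc n)"] by (intro add_left_mono mult_right_mono B pos) auto
  also have "\<dots> = B * (2 * \<Lambda> (\<tau> 0) (\<tau> (Suc n)))"
    using \<Lambda>_add[of "\<tau> 0" "\<tau> n" "\<tau> (Suc n)"] pos monoD[OF \<tau>(1), of 0 n] monoD[OF \<tau>(1), of n "Suc n"]
    by (simp add: algebra_simps)
  finally show ?case .
qed

text \<open>
Only dyadic times are inspected, so that the event is a countable union of measurable sets.
\<close>

definition changes_after :: "nat \<Rightarrow> 'w set" where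
  "changes_after N = {\<omega> \<in> space M. \<exists>j k :: nat. Z (real N + real k / 2 ^ j) \<omega> \<noteq> Z N \<omega>}"

text \<open>
A right-continuous path with values in a discrete space stays for a while at each of its values, and
during this while there is a dyadic time.
\<close>

lemma constant_after:
  assumes \<omega>: "\<omega> \<in> space M" "\<omega> \<notin> changes_after N" and u: "real N \<le> u"
  shows "Z u \<omega> = Z N \<omega>"
proof -
  have "((\<lambda>w. Z w \<omega>) \<longlongrightarrow> Z u \<omega>) (at_right u)"
    using Z_right_cont[OF \<omega>(1), of u] u by (simp add: continuous_within)
  then have "\<forall>\<^sub>F w in at_right u. Z w \<omega> = Z u \<omega>" by (simp add: tendsto_discrete)
  then obtain b where b: "b > u" "\<And>w. u < w \<Longrightarrow> w < b \<Longrightarrow> Z w \<omega> = Z u \<omega>"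
    by (auto simp: eventually_at_right_field)
  obtain j k :: nat where "u < real N + real k / 2 ^ j" "real N + real k / 2 ^ j < b"
    by (rule dyadic_between[OF u b(1)])
  then have "Z (real N + real k / 2 ^ j) \<omega> = Z u \<omega>" by (rule b(2))
  moreover have "Z (real N + real k / 2 ^ j) \<omega> = Z N \<omega>" using \<omega> by (auto simp: changes_after_def)
  ultimately show ?thesis by simp
qed

lemma changes_after_sets: "changes_after N \<in> sets M"
proof -
  have "changes_after N = (\<Union>j. \<Union>k. {\<omega> \<in> space M. Z (real N + real k / 2 ^ j) \<omega> \<noteq> Z N \<omega>})"
    by (auto simp: changes_after_def)
  then show ?thesis using sets_change by auto
qed

text \<open>
The dyadic grids of level \<open>j\<close> are cut off after \<open>j\<close> units of time, so that they are finite and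
increase with \<open>j\<close> to the set of all dyadic times after \<open>N\<close>.
\<close>

lemma prob_changes_after_le:
  assumes B: "\<And>t. 0 \<le> t \<Longrightarrow> mean t \<le> B" and l: "\<And>t. 0 \<le> t \<Longrightarrow> \<Lambda> 0 t \<le> l"
  shows "prob (changes_after N) \<le> B * (2 * (l - \<Lambda> 0 N))"
proof -
  have B0: "0 \<le> B" using B[of 0] mean_pos[of 0] by simp
  define E where "E j = {\<omega> \<in> space M. \<exists>k\<le>j * 2 ^ j. Z (real N + real k / 2 ^ j) \<omega> \<noteq> Z N \<omega>}" for j :: nat
  have le: "prob (E j) \<le> B * (2 * (l - \<Lambda> 0 N))" for j
  proof -
    define \<tau> where "\<tau> k = real N + real k / 2 ^ j" for k :: nat
    have \<tau>: "mono \<tau>" "\<tau> 0 = real N" unfolding \<tau>_def mono_def by (auto intro!: divide_right_mono)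
    have "prob (E j) \<le> B * (2 * \<Lambda> (\<tau> 0) (\<tau> (j * 2 ^ j)))"
      using prob_grid_change_le[OF \<tau>(1) _ B, of "j * 2 ^ j"] \<tau>(2) by (simp add: E_def \<tau>_def)
    also have "\<dots> \<le> B * (2 * (l - \<Lambda> 0 N))"
    proof -
      have "\<tau> 0 \<le> \<tau> (j * 2 ^ j)" using monoD[OF \<tau>(1)] by simp
      then have "\<Lambda> 0 (\<tau> (j * 2 ^ j)) = \<Lambda> 0 N + \<Lambda> (\<tau> 0) (\<tau> (j * 2 ^ j))" "0 \<le> \<tau> (j * 2 ^ j)"
        using \<Lambda>_add[of 0 "real N" "\<tau> (j * 2 ^ j)"] \<tau>(2) by auto
      then show ?thesis using l[of "\<tau> (j * 2 ^ j)"] B0 by (intro mult_left_mono) auto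
    qed
    finally show ?thesis .
  qed
  have sets: "E j \<in> sets M" for j
  proof -
    have "E j = (\<Union>k\<in>{..j * 2 ^ j}. {\<omega> \<in> space M. Z (real N + real k / 2 ^ j) \<omega> \<noteq> Z N \<omega>})"
      by (auto simp: E_def)
    then show ?thesis using sets_change by auto
  qed
  \<comment> \<open>Every dyadic point of level \<open>j\<close> is also one of level \<open>j + i\<close>.\<close>
  have refine: "real (k * 2 ^ i) / 2 ^ (j + i) = real k / 2 ^ j" for k i j :: nat
    by (simp add: power_add)
  have "incseq E"
  proof (rule incseq_SucI, rule subsetI)
    fix j \<omega> assume "\<omega> \<in> E j"
    then obtain k where k: "\<omega> \<in> space M" "k \<le> j * 2 ^ j" "Z (real N + real k / 2 ^ j) \<omega> \<noteq> Z N \<omega>"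
      by (auto simp: E_def)
    have "k * 2 ^ 1 \<le> Suc j * 2 ^ Suc j" using k(2) by simp
    moreover have "Z (real N + real (k * 2 ^ 1) / 2 ^ Suc j) \<omega> \<noteq> Z N \<omega>"
      using k(3) refine[of k 1 j] by simp
    ultimately show "\<omega> \<in> E (Suc j)" using k(1) unfolding E_def by blast
  qed
  then have lim: "(\<lambda>j. prob (E j)) \<longlonglongrightarrow> prob (\<Union>j. E j)"
    by (intro finite_Lim_measure_incseq) (use sets in auto)
  have "(\<Union>j. E j) = changes_after N"
  proof
    show "(\<Union>j. E j) \<subseteq> changes_after N" by (auto simp: E_def changes_after_def)
    show "changes_after N \<subseteq> (\<Union>j. E j)"
    proof
      fix \<omega> assume "\<omega> \<in> changes_after N"
      then obtain j k :: nat where jk: "\<omega> \<in> space M" "Z (real N + real k / 2 ^ j) \<omega> \<noteq> Z N \<omega>"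
        by (auto simp: changes_after_def)
      \<comment> \<open>The point \<open>k / 2 ^ j\<close> is at most \<open>k\<close>, so level \<open>j + k\<close> reaches it.\<close>
      have "k * 2 ^ k \<le> (j + k) * 2 ^ (j + k)"
        by (intro mult_mono power_increasing) auto
      moreover have "Z (real N + real (k * 2 ^ k) / 2 ^ (j + k)) \<omega> \<noteq> Z N \<omega>"
        using jk(2) unfolding refine .
      ultimately have "\<omega> \<in> E (j + k)" using jk(1) unfolding E_def by blast
      then show "\<omega> \<in> (\<Union>j. E j)" by blast
    qed
  qed
  then show ?thesis using LIMSEQ_le_const2[OF lim] le by simp
qed

text \<open>
The events of changing after time \<open>N\<close> have probabilities that are bounded by the tails of a convergent
integral, so almost surely one of them fails.
\<close>

lemma AE_eventually_constant:
  assumes B: "\<And>t. 0 \<le> t \<Longrightarrow> mean t \<le> B" and l: "\<And>t. 0 \<le> t \<Longrightarrow> \<Lambda> 0 t \<le> l"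
    and lim: "((\<lambda>t. \<Lambda> 0 t) \<longlongrightarrow> l) at_top"
  shows "AE \<omega> in M. \<exists>N::nat. \<forall>u\<ge>N. Z u \<omega> = Z N \<omega>"
proof -
  have "(\<lambda>N::nat. \<Lambda> 0 N) \<longlonglongrightarrow> l"
    by (rule filterlim_compose[OF lim filterlim_real_sequentially])
  then have "(\<lambda>N::nat. B * (2 * (l - \<Lambda> 0 N))) \<longlonglongrightarrow> B * (2 * (l - l))"
    by (intro tendsto_intros)
  moreover have "prob (\<Inter>N. changes_after N) \<le> B * (2 * (l - \<Lambda> 0 N))" for N :: nat
  proof -
    have "prob (\<Inter>N. changes_after N) \<le> prob (changes_after N)"
      by (intro finite_measure_mono changes_after_sets) auto
    also have "\<dots> \<le> B * (2 * (l - \<Lambda> 0 N))" by (intro prob_changes_after_le B l)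
    finally show ?thesis .
  qed
  ultimately have "prob (\<Inter>N. changes_after N) \<le> B * (2 * (l - l))"
    by (intro LIMSEQ_le_const) auto
  then have "prob (\<Inter>N. changes_after N) = 0" by (simp add: measure_le_0_iff)
  then have "AE \<omega> in M. \<omega> \<notin> (\<Inter>N. changes_after N)"
    using changes_after_sets by (subst (asm) prob_eq_0) auto
  then show ?thesis
    using AE_space by eventually_elim (use constant_after in blast)
qed

text \<open>
The limit is defined from integer times, and as the least (in fact only) eventual value, to make it
measurable.
\<close>

lemma limit_variable:
  assumes ev: "AE \<omega> in M. \<exists>N::nat. \<forall>u\<ge>N. Z u \<omega> = Z N \<omega>"
  obtains Zinf where "Zinf \<in> measurable M (count_space (UNIV :: nat set))"
    "AE \<omega> in M. ((\<lambda>t. Z t \<omega>) \<longlongrightarrow> Zinf \<omega>) at_top"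
proof -
  define Zinf where "Zinf \<omega> = (LEAST k. \<exists>N::nat. \<forall>n::nat. N \<le> n \<longrightarrow> Z (real n) \<omega> = k)" for \<omega>
  have "Measurable.pred M (\<lambda>\<omega>. \<exists>N::nat. \<forall>n::nat. N \<le> n \<longrightarrow> Z (real n) \<omega> = k)" for k
    by (intro pred_intros_countable pred_intros_logic Z_pred) simp_all
  then have meas: "Zinf \<in> measurable M (count_space UNIV)"
    unfolding Zinf_def by (rule measurable_Least)
  have "AE \<omega> in M. ((\<lambda>t. Z t \<omega>) \<longlongrightarrow> Zinf \<omega>) at_top"
    using ev
  proof eventually_elim
    case (elim \<omega>)
    then obtain N :: nat where N: "\<And>u::real. u \<ge> N \<Longrightarrow> Z u \<omega> = Z N \<omega>" by blast
    have eq: "Zinf \<omega> = Z N \<omega>"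
      unfolding Zinf_def
    proof (rule Least_equality)
      show "\<exists>N'::nat. \<forall>n::nat. N' \<le> n \<longrightarrow> Z (real n) \<omega> = Z N \<omega>"
        by (intro exI[of _ N] allI impI N) simp
      fix k assume "\<exists>N'::nat. \<forall>n::nat. N' \<le> n \<longrightarrow> Z (real n) \<omega> = k"
      then obtain N' where "\<And>n. N' \<le> n \<Longrightarrow> Z (real n) \<omega> = k" by blast
      then have "Z (real (max N N')) \<omega> = k" by simp
      then show "Z N \<omega> \<le> k" using N[of "real (max N N')"] by simp
    qed
    have "\<forall>\<^sub>F t in at_top. Z t \<omega> = Zinf \<omega>"
      using eventually_ge_at_top[of "real N"]
    proof eventually_elim
      case (elim t)
      then show ?case unfolding eq by (rule N)
    qed
    then show ?case by (rule tendsto_eventually)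
  qed
  with meas show ?thesis by (rule that)
qed

lemma pgf_limit:
  assumes meas: "Zinf \<in> measurable M (count_space (UNIV :: nat set))"
    and conv: "AE \<omega> in M. ((\<lambda>t. Z t \<omega>) \<longlongrightarrow> Zinf \<omega>) at_top"
    and v: "v \<in> {0..1}" and lim: "((\<lambda>t. F 0 t v) \<longlongrightarrow> L) at_top"
  shows "expectation (\<lambda>\<omega>. v ^ Zinf \<omega>) = L"
proof -
  have "(\<lambda>n. expectation (\<lambda>\<omega>. v ^ Z (real n) \<omega>)) \<longlonglongrightarrow> expectation (\<lambda>\<omega>. v ^ Zinf \<omega>)"
  proof (rule integral_dominated_convergence[where w="\<lambda>_. 1"])
    show "(\<lambda>\<omega>. v ^ Zinf \<omega>) \<in> borel_measurable M"
      using meas by (rule measurable_compose) simp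
    show "(\<lambda>\<omega>. v ^ Z (real n) \<omega>) \<in> borel_measurable M" for n
      using Z_meas0[of "real n"] by (rule measurable_compose[of _ _ "count_space UNIV"]) auto
    show "AE \<omega> in M. (\<lambda>n. v ^ Z (real n) \<omega>) \<longlonglongrightarrow> v ^ Zinf \<omega>"
      using conv
    proof eventually_elim
      case (elim \<omega>)
      then have "\<forall>\<^sub>F n in sequentially. Z (real n) \<omega> = Zinf \<omega>"
        using filterlim_compose[OF elim filterlim_real_sequentially] by (simp add: tendsto_discrete)
      then show ?case by (intro tendsto_eventually) (auto elim: eventually_mono)
    qed
    show "AE \<omega> in M. norm (v ^ Z (real n) \<omega>) \<le> 1" for n
      using v by (intro always_eventually) (auto intro: power_le_one)
  qed simp
  moreover have "(\<lambda>n. expectation (\<lambda>\<omega>. v ^ Z (real n) \<omega>)) \<longlonglongrightarrow> L"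
    using filterlim_compose[OF lim filterlim_real_sequentially] by (simp add: expectation_power_Z)
  ultimately show ?thesis by (rule LIMSEQ_unique)
qed


section \<open>Asymptotic degeneracy and the law of the limit\<close>

lemma eventually_mean_size: "\<forall>\<^sub>F t in at_top. mean t = mean_size M Z t"
  using eventually_ge_at_top[of 0] by eventually_elim (simp add: mean_size_eq)

lemma V_fun_eq:
  assumes "0 \<le> t"
  shows "V_fun M Z \<theta> lam t = V t"
proof -
  have "(LBINT u:{0..t}. mean_size M Z u powr (-\<theta>) * lam u) = (LBINT u:{0..t}. mean u powr (-\<theta>) * lam u)"
    by (rule set_lebesgue_integral_cong) (auto simp: mean_size_eq)
  then show ?thesis by (simp add: V_fun_def V_def)
qed

lemma V_lim_eq:
  assumes "(V \<longlongrightarrow> v) at_top"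
  shows "V_lim M Z \<theta> lam = ereal v"
proof -
  have "(V_fun M Z \<theta> lam \<longlongrightarrow> v) at_top"
    using assms
    by (rule Lim_transform_eventually)
       (use eventually_ge_at_top[of 0] in \<open>eventually_elim, simp add: V_fun_eq\<close>)
  then show ?thesis unfolding V_lim_def by (intro tendsto_Lim) auto
qed

lemma extinction_prob_eqI:
  assumes "((\<lambda>t. pmf (P 0 t 1) 0) \<longlongrightarrow> q) at_top"
  shows "extinction_prob M Z = q"
proof -
  have "((\<lambda>t. prob {\<omega> \<in> space M. Z t \<omega> = 0}) \<longlongrightarrow> q) at_top"
    using assms
    by (rule Lim_transform_eventually)
       (use eventually_ge_at_top[of 0] in \<open>eventually_elim, simp add: prob_Z\<close>)
  then show ?thesis unfolding extinction_prob_def by (intro tendsto_Lim) auto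
qed

text \<open>
If the process is asymptotically degenerate, the mean does not tend to infinity, which is the
hypothesis of \<open>bounded_rate_if_survival\<close>.
\<close>

lemma degenerate_iff: "asymptotically_degenerate M Z \<longleftrightarrow> total_rate lam < \<infinity>"
  unfolding total_rate_finite_iff
proof
  assume deg: "asymptotically_degenerate M Z"
  obtain q where q: "((\<lambda>t. pmf (P 0 t 1) 0) \<longlongrightarrow> q) at_top" "\<forall>t\<ge>0. pmf (P 0 t 1) 0 \<le> q"
    by (rule tendsto_at_top_mono_bounded[OF extinction_mono pmf_le_1])
  have "q < 1" using deg extinction_prob_eqI[OF q(1)] by (simp add: asymptotically_degenerate_def)
  moreover have "\<not> filterlim mean at_top at_top"
  proof
    assume "filterlim mean at_top at_top"
    then have "filterlim (mean_size M Z) at_top at_top"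
      using filterlim_cong[OF refl refl eventually_mean_size] by simp
    then have "((\<lambda>t. ereal (mean_size M Z t)) \<longlongrightarrow> \<infinity>) at_top"
      by (simp add: tendsto_PInfty_eq_at_top)
    then have "Liminf at_top (\<lambda>t. ereal (mean_size M Z t)) = \<infinity>"
      by (intro lim_imp_Liminf) auto
    with deg show False by (simp add: asymptotically_degenerate_def)
  qed
  ultimately show "\<exists>B. \<forall>t\<ge>0. \<Lambda> 0 t \<le> B" by (intro bounded_rate_if_survival[OF q(2)[rule_format]])
next
  assume "\<exists>B. \<forall>t\<ge>0. \<Lambda> 0 t \<le> B"
  then obtain B where B: "\<And>t. 0 \<le> t \<Longrightarrow> \<Lambda> 0 t \<le> B" by blast
  obtain \<mu> v where lim: "0 < \<mu>" "(mean \<longlongrightarrow> \<mu>) at_top" "(V \<longlongrightarrow> v) at_top" "0 \<le> v"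
    by (rule finite_rate_limits[OF B])
  have zero: "0 \<in> {0..<1::real}" by simp
  have "extinction_prob M Z < 1"
    using extinction_prob_eqI[OF survival_limit(2)[OF lim(2,1,3,4) zero, unfolded pgf_0]]
      survival_limit(1)[OF lim(2,1,3,4) zero] by simp
  moreover have "(mean_size M Z \<longlongrightarrow> \<mu>) at_top"
    by (rule Lim_transform_eventually[OF lim(2) eventually_mean_size])
  then have "Liminf at_top (\<lambda>t. ereal (mean_size M Z t)) = ereal \<mu>"
    by (intro lim_imp_Liminf) auto
  ultimately show "asymptotically_degenerate M Z"
    by (simp add: asymptotically_degenerate_def)
qed

lemma finite_rate_limit_law:
  assumes "total_rate lam < \<infinity>"
  shows "V_lim M Z \<theta> lam < \<infinity> \<and>
       (\<exists>\<mu>. 0 < \<mu> \<and> (mean_size M Z \<longlongrightarrow> \<mu>) at_top \<and>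
          (\<exists>Zinf \<in> measurable M (count_space (UNIV :: nat set)).
             (AE \<omega> in M. ((\<lambda>t. Z t \<omega>) \<longlongrightarrow> Zinf \<omega>) at_top) \<and>
             (\<forall>s\<in>{0..1}. (\<integral>\<omega>. s ^ Zinf \<omega> \<partial>M) =
                (if s = 1 then 1
                 else 1 - (real_of_ereal (V_lim M Z \<theta> lam)
                             + (1 - \<mu> powr (-\<theta>)) / (1 + \<theta>)
                             + \<mu> powr (-\<theta>) * (1 - s) powr (-\<theta>)) powr (- 1 / \<theta>)))))"
proof -
  obtain B where B: "\<And>t. 0 \<le> t \<Longrightarrow> \<Lambda> 0 t \<le> B"
    using assms unfolding total_rate_finite_iff by blast
  obtain \<mu> v where lim: "0 < \<mu>" "(mean \<longlongrightarrow> \<mu>) at_top" "(V \<longlongrightarrow> v) at_top" "0 \<le> v"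
    and mean_le: "\<forall>t\<ge>0. mean t \<le> exp (max_offspring_mean * B)"
    by (rule finite_rate_limits[OF B])
  obtain l where l: "((\<lambda>t. \<Lambda> 0 t) \<longlongrightarrow> l) at_top" "\<forall>t\<ge>0. \<Lambda> 0 t \<le> l"
    by (rule tendsto_at_top_mono_bounded[OF \<Lambda>_0_mono B])
  obtain Zinf where Zinf: "Zinf \<in> measurable M (count_space (UNIV :: nat set))"
    "AE \<omega> in M. ((\<lambda>t. Z t \<omega>) \<longlongrightarrow> Zinf \<omega>) at_top"
    by (rule limit_variable[OF AE_eventually_constant[OF mean_le[rule_format] l(2)[rule_format] l(1)]])
  have V: "V_lim M Z \<theta> lam = ereal v" by (rule V_lim_eq[OF lim(3)])
  show ?thesis
  proof (intro conjI exI[of _ \<mu>] bexI[of _ Zinf] ballI)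
    show "V_lim M Z \<theta> lam < \<infinity>" unfolding V by simp
    show "(mean_size M Z \<longlongrightarrow> \<mu>) at_top"
      by (rule Lim_transform_eventually[OF lim(2) eventually_mean_size])
    fix s :: real assume s: "s \<in> {0..1}"
    show "(\<integral>\<omega>. s ^ Zinf \<omega> \<partial>M) = (if s = 1 then 1
                 else 1 - (real_of_ereal (V_lim M Z \<theta> lam)
                             + (1 - \<mu> powr (-\<theta>)) / (1 + \<theta>)
                             + \<mu> powr (-\<theta>) * (1 - s) powr (-\<theta>)) powr (- 1 / \<theta>))"
    proof (cases "s = 1")
      case True
      then show ?thesis by (simp add: prob_space)
    next
      case False
      then have "s \<in> {0..<1}" using s by auto
      then show ?thesis
        using pgf_limit[OF Zinf s survival_limit(2)[OF lim(2,1,3,4)]] False unfolding V by simp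
    qed
  qed (use lim Zinf in auto)
qed

end

theorem theorem2p3:
  fixes M :: "'w measure" and Z :: "real \<Rightarrow> 'w \<Rightarrow> nat"
    and \<theta> :: real and lam a :: "real \<Rightarrow> real"
  assumes "theta_positive_process M Z \<theta> lam a"
  shows "(asymptotically_degenerate M Z \<longleftrightarrow> total_rate lam < \<infinity>) \<and>
    (total_rate lam < \<infinity> \<longrightarrow>
       V_lim M Z \<theta> lam < \<infinity> \<and>
       (\<exists>\<mu>. 0 < \<mu> \<and> (mean_size M Z \<longlongrightarrow> \<mu>) at_top \<and>
          (\<exists>Zinf \<in> measurable M (count_space (UNIV :: nat set)).
             (AE \<omega> in M. ((\<lambda>t. Z t \<omega>) \<longlongrightarrow> Zinf \<omega>) at_top) \<and>
             (\<forall>s\<in>{0..1}. (\<integral>\<omega>. s ^ Zinf \<omega> \<partial>M) =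
                (if s = 1 then 1
                 else 1 - (real_of_ereal (V_lim M Z \<theta> lam)
                             + (1 - \<mu> powr (-\<theta>)) / (1 + \<theta>)
                             + \<mu> powr (-\<theta>) * (1 - s) powr (-\<theta>)) powr (- 1 / \<theta>))))))"
proof -
  obtain p where p: "\<forall>t\<ge>0. \<forall>s\<in>{0..1}. (\<lambda>k. pmf (p t) k * s ^ k) sums theta_pgf \<theta> (a t) s"
      "markov_branching_process M lam p Z"
    using assms unfolding theta_positive_process_def by (elim conjE exE)
  obtain P where P: "branching_transitions lam p P"
      "\<forall>(\<tau> :: nat \<Rightarrow> real) (x :: nat \<Rightarrow> nat) (m :: nat). \<tau> 0 = 0 \<and> mono \<tau> \<longrightarrow>
           measure M {\<omega> \<in> space M. \<forall>i\<le>m. Z (\<tau> i) \<omega> = x i} =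
             of_bool (x 0 = 1) * (\<Prod>i<m. pmf (P (\<tau> i) (\<tau> (Suc i)) (x i)) (x (Suc i)))"
    using p(2) unfolding markov_branching_process_def by (elim conjE exE)
  interpret prob_space M using p(2) unfolding markov_branching_process_def by (elim conjE)
  interpret theta_process \<theta> lam a p P M Z
  proof unfold_locales
    fix t s :: real assume "0 \<le> t" "s \<in> {0..1}"
    then show "(\<lambda>k. pmf (p t) k * s ^ k) sums theta_pgf \<theta> (a t) s" using p(1) by blast
  next
    fix \<tau> :: "nat \<Rightarrow> real" and x :: "nat \<Rightarrow> nat" and m :: nat
    assume "\<tau> 0 = 0" "mono \<tau>"
    then show "measure M {\<omega> \<in> space M. \<forall>i\<le>m. Z (\<tau> i) \<omega> = x i} =
             of_bool (x 0 = 1) * (\<Prod>i<m. pmf (P (\<tau> i) (\<tau> (Suc i)) (x i)) (x (Suc i)))"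
      using P(2)[THEN spec[of _ \<tau>], THEN spec[of _ x], THEN spec[of _ m]] by blast
  next
    show "branching_transitions lam p P" by (rule P(1))
  qed (use assms p(2) in \<open>simp_all add: theta_positive_process_def markov_branching_process_def\<close>)
  show ?thesis using degenerate_iff finite_rate_limit_law by blast
qed

end
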